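(* Let $G$ be a countable directed graph with no sinks. Suppose $\{S_e, P_x\}$ and $\{S'_e, P'_x\}$ ($e\in E(G)$, $x\in V(G)$) are families acting on Hilbert spaces which both satisfy the relations $(\dagger)$ for $G$, and suppose they are jointly similar, i.e. there is an invertible bounded operator $A$ with $$A S_e A^{-1} = S'_e \quad (e\in E(G)), \qquad A P_x A^{-1} = P'_x \quad (x\in V(G)).$$ Then they are jointly unitarily equivalent: there is a unitary operator $U$ such that $$U S_e U^{*} = S'_e \quad (e\in E(G)), \qquad U P_x U^{*} = P'_x \quad (x\in V(G)).$$
   Context: $G$ is a countable directed graph with edge set $E(G)$ and vertex set $V(G)$; $s(e)$, $r(e)$ denote the source and range vertices of an edge $e$. $G$ has no sinks if for every $x\in V(G)$ there is $e\in E(G)$ with $s(e)=x$. A family of non-zero partial isometries $\{S_e : e\in E(G)\}$ and non-zero (orthogonal) projections $\{P_x : x\in V(G)\}$ on a common Hilbert space satisfies $(\dagger)$ for $G$ if: (i) $P_xP_y=0$ for all $x\neq y$ in $V(G)$; (ii) $S_e^*S_f=0$ for all $e\neq f$ in $E(G)$; (iii) $S_e^*S_e=P_{s(e)}$ for all $e\in E(G)$; (iv) $\sum_{r(e)=x} S_eS_e^*\le P_x$ for all $x\in V(G)$ (infinite sums converge in the strong operator topology; empty sums are $0$). *)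

theory Defs
  imports "HOL-Analysis.Analysis" "Graph_Theory.Digraph"
begin

text \<open>
  Complex inner product spaces are real inner product spaces with a compatible complex structure:
  the real inner product is the real part of the complex one, so that norm and topology
  are those of \<^class>\<open>real_inner\<close>. The complex inner product is linear in its first argument.
\<close>

class complex_inner = real_inner +
  fixes scaleC :: "complex \<Rightarrow> 'a \<Rightarrow> 'a"
    and cinner :: "'a \<Rightarrow> 'a \<Rightarrow> complex"
  assumes scaleC_add_right: "scaleC c (x + y) = scaleC c x + scaleC c y"
    and scaleC_add_left: "scaleC (c + d) x = scaleC c x + scaleC d x"
    and scaleC_scaleC: "scaleC c (scaleC d x) = scaleC (c * d) x"
    and scaleC_of_real: "scaleC (complex_of_real r) x = scaleR r x"
    and cinner_commute: "cinner x y = cnj (cinner y x)"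
    and cinner_add_left: "cinner (x + y) z = cinner x z + cinner y z"
    and cinner_scaleC_left: "cinner (scaleC c x) y = c * cinner x y"
    and inner_eq_Re_cinner: "inner x y = Re (cinner x y)"

class chilbert_space = complex_inner + complete_space

subclass (in chilbert_space) banach ..

text \<open>
  Operators are functions. For the bounded operators between Hilbert spaces
  to which it is applied, the adjoint exists and is unique by the Riesz representation theorem.
\<close>

definition bounded_clinear :: "('a::complex_inner \<Rightarrow> 'b::complex_inner) \<Rightarrow> bool" where
  "bounded_clinear T \<longleftrightarrow> bounded_linear T \<and> (\<forall>c x. T (scaleC c x) = scaleC c (T x))"

definition cadjoint :: "('a::complex_inner \<Rightarrow> 'b::complex_inner) \<Rightarrow> 'b \<Rightarrow> 'a" where
  "cadjoint T = (THE T'. \<forall>x y. cinner (T x) y = cinner x (T' y))"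

definition partial_isometry :: "('a::complex_inner \<Rightarrow> 'b::complex_inner) \<Rightarrow> bool" where
  "partial_isometry T \<longleftrightarrow> bounded_clinear T \<and>
     (\<forall>x. (\<forall>y. T y = 0 \<longrightarrow> cinner x y = 0) \<longrightarrow> norm (T x) = norm x)"

definition orthogonal_projection :: "('a::complex_inner \<Rightarrow> 'a) \<Rightarrow> bool" where
  "orthogonal_projection P \<longleftrightarrow> bounded_clinear P \<and> P \<circ> P = P \<and> cadjoint P = P"

definition unitary :: "('a::complex_inner \<Rightarrow> 'b::complex_inner) \<Rightarrow> bool" where
  "unitary U \<longleftrightarrow> bounded_clinear U \<and> cadjoint U \<circ> U = id \<and> U \<circ> cadjoint U = id"

definition bounded_invertible :: "('a::complex_inner \<Rightarrow> 'b::complex_inner) \<Rightarrow> bool" where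
  "bounded_invertible A \<longleftrightarrow> bounded_clinear A \<and> bij A \<and> bounded_clinear (inv A)"

definition operator_le :: "('a::complex_inner \<Rightarrow> 'a) \<Rightarrow> ('a \<Rightarrow> 'a) \<Rightarrow> bool" where
  "operator_le A B \<longleftrightarrow> (\<forall>x. cinner (B x - A x) x \<in> \<real>\<^sub>\<ge>\<^sub>0)"

definition has_sum_strong ::
    "('i \<Rightarrow> 'a::complex_inner \<Rightarrow> 'b::complex_inner) \<Rightarrow> ('a \<Rightarrow> 'b) \<Rightarrow> 'i set \<Rightarrow> bool" where
  "has_sum_strong F T I \<longleftrightarrow> bounded_clinear T \<and> (\<forall>v. ((\<lambda>i. F i v) has_sum T v) I)"

text \<open>
  In a \<^locale>\<open>pre_digraph\<close> the source of an edge is its tail and the range is its head.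
  The families are indexed by whole types, but constrained only on vertices and edges of the graph.
\<close>

definition dagger_family ::
    "('v, 'e) pre_digraph \<Rightarrow> ('e \<Rightarrow> 'a::chilbert_space \<Rightarrow> 'a) \<Rightarrow> ('v \<Rightarrow> 'a \<Rightarrow> 'a) \<Rightarrow> bool" where
  "dagger_family G S P \<longleftrightarrow>
     (\<forall>e\<in>arcs G. partial_isometry (S e) \<and> S e \<noteq> (\<lambda>_. 0)) \<and>
     (\<forall>x\<in>verts G. orthogonal_projection (P x) \<and> P x \<noteq> (\<lambda>_. 0)) \<and>
     (\<forall>x\<in>verts G. \<forall>y\<in>verts G. x \<noteq> y \<longrightarrow> P x \<circ> P y = (\<lambda>_. 0)) \<and>
     (\<forall>e\<in>arcs G. \<forall>f\<in>arcs G. e \<noteq> f \<longrightarrow> cadjoint (S e) \<circ> S f = (\<lambda>_. 0)) \<and>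
     (\<forall>e\<in>arcs G. cadjoint (S e) \<circ> S e = P (tail G e)) \<and>
     (\<forall>x\<in>verts G. \<exists>T. has_sum_strong (\<lambda>e. S e \<circ> cadjoint (S e)) T {e \<in> arcs G. head G e = x} \<and>
        operator_le T (P x))"

end

theory Submission
  imports Defs
begin

text \<open>
  A similarity that also intertwines the adjoints \<open>(S e)\<^sup>*\<close> can be replaced by the unitary factor
  of its polar decomposition, since that factor inherits all the relations (\<open>unitary_part\<close>). The given
  similarity \<open>A\<close> need not intertwine the adjoints, and the proof consists in correcting it
  (\<open>similar_rows.star_similarity\<close>).

  The guide is the Wold decomposition. Let \<open>R = \<Sum>e. S e (S e)\<^sup>*\<close>. The space splits orthogonally into
  the images of the wandering space \<open>ran (1 - R)\<close> under words of all lengths and a remaining part that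
  lies, for every \<open>n\<close>, in the closed span of the ranges of the words of length \<open>n\<close>.
  On the latter, \<open>A\<close> intertwines the adjoints automatically: there \<open>A = \<Sum>f. S' f A (S f)\<^sup>*\<close>, and applying \<open>(S' e)\<^sup>*\<close> leaves \<open>A (S e)\<^sup>*\<close>.
  On wandering spaces, \<open>A\<close> maps \<open>ran R\<close> onto \<open>ran R'\<close>, so its compression
  \<open>(1 - R') A (1 - R)\<close> is invertible from \<open>ran (1 - R)\<close> onto \<open>ran (1 - R')\<close>, and this
  compression is transported along the words to all images of the wandering space.

  The decomposition itself is never formed. The corrected operator is a fixed point of
  \<open>X \<mapsto> (1 - R') A + \<Sum>e. S' e X (S e)\<^sup>*\<close> (\<open>diagonal_step\<close>), obtained as the strong limit of the iterates
  that start at \<open>A\<close>. All iterates have norm at most \<open>\<parallel>A\<parallel>\<close>, and the corresponding iterates that start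
  at the inverse of \<open>A\<close> invert them (\<open>step_inverse\<close>), so the limit is invertible.
  Convergence comes from the convergence of the decreasing projections onto the spans of the words of
  length \<open>n\<close> (\<open>approximant_convergent\<close>).

  The operator theory takes place in real Hilbert spaces. Complex linearity enters as
  commutation with the scalars, which are treated on a par with the vertex projections.
\<close>

section \<open>Adjoints in real Hilbert spaces\<close>

text \<open>
  The representing vector is the minimiser of the strictly convex functional \<open>\<parallel>x\<parallel>\<^sup>2 / 2 - f x\<close>:
  the parallelogram law makes minimising sequences Cauchy, and the vanishing of the derivative
  at the minimum is the representation.
\<close>

lemma riesz_representation:
  fixes f :: "'a::{real_inner, banach} \<Rightarrow> real"
  assumes "bounded_linear f"
  shows "\<exists>y. \<forall>x. f x = inner x y"
proof -
  interpret f: bounded_linear f by fact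
  define g where "g x = (norm x)\<^sup>2 / 2 - f x" for x
  obtain K where K: "\<And>x. norm (f x) \<le> norm x * K"
    using f.bounded by blast
  have lower: "- (K\<^sup>2 / 2) \<le> g x" for x
  proof -
    have "f x \<le> norm x * K" using K[of x] by simp
    moreover have "0 \<le> (norm x - K)\<^sup>2" by simp
    ultimately show ?thesis unfolding g_def by (simp add: power2_diff field_simps)
  qed
  define m where "m = (INF x. g x)"
  have bdd: "bdd_below (range g)" using lower by (auto intro!: bdd_belowI2)
  have m_le: "m \<le> g x" for x unfolding m_def by (rule cINF_lower[OF bdd]) simp
  have close: "(norm (x - y))\<^sup>2 \<le> 4 * (g x - m) + 4 * (g y - m)" for x y
  proof -
    have "g ((1/2) *\<^sub>R (x + y)) = (norm (x + y))\<^sup>2 / 8 - (f x + f y) / 2"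
      by (simp add: g_def f.scaleR f.add power_divide)
    moreover have "(norm (x + y))\<^sup>2 + (norm (x - y))\<^sup>2 = 2 * (norm x)\<^sup>2 + 2 * (norm y)\<^sup>2"
      by (simp add: power2_norm_eq_inner algebra_simps inner_commute)
    ultimately show ?thesis
      using m_le[of "(1/2) *\<^sub>R (x + y)"] unfolding g_def by (simp add: field_simps)
  qed
  have "\<exists>x. g x < m + inverse (real (Suc n))" for n
    using cINF_less_iff[of UNIV g "m + inverse (real (Suc n))"] bdd unfolding m_def by auto
  then obtain X where X: "\<And>n. g (X n) < m + inverse (real (Suc n))" by metis
  have g_lim: "(\<lambda>n. g (X n)) \<longlonglongrightarrow> m"
  proof (rule tendsto_sandwich[OF _ _ tendsto_const])
    show "(\<lambda>n. m + inverse (real (Suc n))) \<longlonglongrightarrow> m"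
      using tendsto_add[OF tendsto_const LIMSEQ_inverse_real_of_nat, of m] by simp
  qed (use m_le X in \<open>auto intro!: always_eventually less_imp_le\<close>)
  have "Cauchy X"
  proof (rule metric_CauchyI)
    fix e :: real assume "e > 0"
    then have "eventually (\<lambda>n. g (X n) < m + e\<^sup>2 / 8) sequentially"
      using order_tendstoD(2)[OF g_lim, of "m + e\<^sup>2 / 8"] by simp
    then obtain N where N: "\<And>n. n \<ge> N \<Longrightarrow> g (X n) < m + e\<^sup>2 / 8"
      by (auto simp: eventually_sequentially)
    have "dist (X i) (X j) < e" if "i \<ge> N" "j \<ge> N" for i j
    proof -
      have "(norm (X i - X j))\<^sup>2 < e\<^sup>2"
        using close[of "X i" "X j"] N[OF that(1)] N[OF that(2)] by simp
      then show ?thesis using \<open>e > 0\<close> power2_less_imp_less[of "norm (X i - X j)" e]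
        by (simp add: dist_norm)
    qed
    then show "\<exists>N. \<forall>i\<ge>N. \<forall>j\<ge>N. dist (X i) (X j) < e" by blast
  qed
  then obtain y where y: "X \<longlonglongrightarrow> y" using Cauchy_convergent convergent_def by blast
  have "(\<lambda>n. g (X n)) \<longlonglongrightarrow> g y"
    unfolding g_def by (intro tendsto_intros f.tendsto y) simp
  then have gy: "g y = m" using g_lim LIMSEQ_unique by blast
  have "f x = inner x y" for x
  proof (cases "x = 0")
    case False
    \<comment> \<open>the step \<open>t\<close> minimises the quadratic polynomial \<open>g (y + t x)\<close>\<close>
    define d t where "d = inner x y - f x" and "t = - d / (norm x)\<^sup>2"
    have min: "g y \<le> g (y + t *\<^sub>R x)" using m_le gy by simp
    have "(norm (y + t *\<^sub>R x))\<^sup>2 = (norm y)\<^sup>2 + 2 * t * inner x y + t\<^sup>2 * (norm x)\<^sup>2"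
      unfolding power2_norm_eq_inner
      by (simp add: inner_simps inner_commute power2_eq_square algebra_simps)
    then have "g (y + t *\<^sub>R x) = g y + (t * d + t\<^sup>2 * (norm x)\<^sup>2 / 2)"
      by (simp add: g_def d_def f.add f.scaleR algebra_simps)
    moreover have "t * d + t\<^sup>2 * (norm x)\<^sup>2 / 2 = - (d\<^sup>2 / (2 * (norm x)\<^sup>2))"
      using False by (simp add: t_def field_simps power2_eq_square)
    ultimately have "d\<^sup>2 / (2 * (norm x)\<^sup>2) \<le> 0" using min by linarith
    then have "d\<^sup>2 \<le> 0" using False by (simp add: divide_le_0_iff)
    then show ?thesis by (simp add: d_def)
  qed (simp add: f.zero)
  then show ?thesis by blast
qed

definition adj ::
    "('a::{real_inner, banach} \<Rightarrow>\<^sub>L 'b::{real_inner, banach}) \<Rightarrow> 'b \<Rightarrow>\<^sub>L 'a" where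
  "adj T = (SOME T' :: 'b \<Rightarrow>\<^sub>L 'a. \<forall>x y. inner (T x) y = inner x (T' y))"

lemma inner_adj_right:
  fixes T :: "'a::{real_inner, banach} \<Rightarrow>\<^sub>L 'b::{real_inner, banach}"
  shows "inner x (adj T y) = inner (T x) y"
proof -
  have "\<exists>z. \<forall>x. inner (T x) y = inner x z" for y
    by (rule riesz_representation) (intro bounded_linear_intros)
  then obtain h where h: "\<And>x y. inner (T x) y = inner x (h y)" by metis
  have "bounded_linear h"
  proof (rule bounded_linear_intro)
    show "h (a + b) = h a + h b" for a b
      by (rule vector_eq_rdot[THEN iffD1])
        (metis h inner_add_right inner_commute)
    show "h (r *\<^sub>R a) = r *\<^sub>R h a" for r a
      by (rule vector_eq_rdot[THEN iffD1])
        (metis h inner_scaleR_right inner_commute)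
    show "norm (h a) \<le> norm a * norm T" for a
    proof (cases "h a = 0")
      case False
      have "(norm (h a))\<^sup>2 = inner (T (h a)) a"
        by (simp add: h power2_norm_eq_inner)
      also have "\<dots> \<le> norm (T (h a)) * norm a" by (rule norm_cauchy_schwarz)
      also have "\<dots> \<le> norm T * norm (h a) * norm a"
        by (intro mult_right_mono norm_blinfun) simp
      finally show ?thesis using False by (simp add: power2_eq_square mult_ac)
    qed simp
  qed
  then have "\<forall>x y. inner (T x) y = inner x (Blinfun h y)"
    by (simp add: bounded_linear_Blinfun_apply h)
  then have "\<forall>x y. inner (T x) y = inner x (adj T y)"
    unfolding adj_def by (rule someI)
  then show ?thesis by simp
qed

lemma inner_adj_left:
  fixes T :: "'a::{real_inner, banach} \<Rightarrow>\<^sub>L 'b::{real_inner, banach}"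
  shows "inner (adj T y) x = inner y (T x)"
  by (metis inner_adj_right inner_commute)

lemma adj_eqI:
  fixes T :: "'a::{real_inner, banach} \<Rightarrow>\<^sub>L 'b::{real_inner, banach}" and T' :: "'b \<Rightarrow>\<^sub>L 'a"
  assumes "\<And>x y. inner (T x) y = inner x (T' y)"
  shows "adj T = T'"
  by (rule blinfun_eqI, rule vector_eq_rdot[THEN iffD1])
    (metis assms inner_adj_right inner_commute)

lemma adj_adj [simp]: "adj (adj T) = T"
  by (rule adj_eqI) (simp add: inner_adj_left)

lemma adj_id [simp]: "adj id_blinfun = id_blinfun"
  by (rule adj_eqI) simp

lemma adj_zero [simp]: "adj 0 = 0"
  by (rule adj_eqI) simp

lemma adj_compose: "adj (S o\<^sub>L T) = adj T o\<^sub>L adj S"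
  by (rule adj_eqI) (simp add: inner_adj_right)

lemma norm_adj_le: "norm (adj T) \<le> norm T"
proof (rule norm_blinfun_bound)
  fix y
  show "norm (adj T y) \<le> norm T * norm y"
  proof (cases "adj T y = 0")
    case False
    have "(norm (adj T y))\<^sup>2 = inner (T (adj T y)) y"
      by (simp add: power2_norm_eq_inner inner_adj_right)
    also have "\<dots> \<le> norm (T (adj T y)) * norm y" by (rule norm_cauchy_schwarz)
    also have "\<dots> \<le> norm T * norm (adj T y) * norm y"
      by (intro mult_right_mono norm_blinfun) simp
    finally show ?thesis using False by (simp add: power2_eq_square mult_ac)
  qed simp
qed simp

lemma bounded_linear_adj: "bounded_linear adj"
proof (rule bounded_linear_intro)
  show "adj (S + T) = adj S + adj T" for S T :: "'a \<Rightarrow>\<^sub>L 'b"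
    by (rule adj_eqI) (simp add: blinfun.bilinear_simps inner_simps inner_adj_right)
  show "adj (r *\<^sub>R T) = r *\<^sub>R adj T" for r and T :: "'a \<Rightarrow>\<^sub>L 'b"
    by (rule adj_eqI) (simp add: blinfun.bilinear_simps inner_simps inner_adj_right)
  show "norm (adj T) \<le> norm T * 1" for T :: "'a \<Rightarrow>\<^sub>L 'b"
    using norm_adj_le[of T] by simp
qed

lemma adj_scaleR: "adj (r *\<^sub>R T) = r *\<^sub>R adj T"
  using bounded_linear_adj by (rule linear_simps(5))

text \<open>
  Intertwining adjoints as well is what makes the unitary part inherit the relation:
  then \<open>X\<^sup>* X\<close> commutes with \<open>T\<close>, and so does every function of it.
\<close>

definition star_intertwines :: "('a::{real_inner, banach} \<Rightarrow>\<^sub>L 'b::{real_inner, banach}) \<Rightarrow>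
    ('a \<Rightarrow>\<^sub>L 'a) \<Rightarrow> ('b \<Rightarrow>\<^sub>L 'b) \<Rightarrow> bool" where
  "star_intertwines X T T' \<longleftrightarrow>
     (\<forall>v. X (T v) = T' (X v)) \<and> (\<forall>v. X (adj T v) = adj T' (X v))"

lemma star_intertwines_adj:
  assumes "star_intertwines X T T'"
  shows "adj X (T' w) = T (adj X w)"
proof (rule vector_eq_rdot[THEN iffD1], rule allI)
  fix z
  have "inner (adj X (T' w)) z = inner w (adj T' (X z))"
    by (simp add: inner_adj_left inner_adj_right)
  also have "\<dots> = inner w (X (adj T z))" using assms by (simp add: star_intertwines_def)
  also have "\<dots> = inner (T (adj X w)) z" by (simp add: inner_adj_left flip: inner_adj_right[of _ T])
  finally show "inner (adj X (T' w)) z = inner (T (adj X w)) z" .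
qed

section \<open>The unitary part of an invertible operator\<close>

text \<open>
  The Newton--Schulz iteration \<open>X \<mapsto> X (1 + (1 - X\<^sup>* X) / 2)\<close>. Its limit is the unitary factor in the
  polar decomposition; being built from sums and products of \<open>X\<close> and \<open>X\<^sup>*\<close> alone, it needs
  neither square roots of positive operators nor inverses.
\<close>

definition newton ::
    "('a::{real_inner, banach} \<Rightarrow>\<^sub>L 'b::{real_inner, banach}) \<Rightarrow> 'a \<Rightarrow>\<^sub>L 'b" where
  "newton X = (3/2) *\<^sub>R X - (1/2) *\<^sub>R (X o\<^sub>L adj X o\<^sub>L X)"

definition almost_isometry ::
    "real \<Rightarrow> ('a::{real_inner, banach} \<Rightarrow>\<^sub>L 'b::{real_inner, banach}) \<Rightarrow> bool" where
  "almost_isometry q X \<longleftrightarrow> (\<forall>v. norm (v - adj X (X v)) \<le> q * norm v)"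

lemma adj_newton: "adj (newton X) = newton (adj X)"
proof -
  have "adj (X o\<^sub>L adj X o\<^sub>L X) = adj X o\<^sub>L adj (adj X) o\<^sub>L adj X"
    by (rule blinfun_eqI) (simp add: adj_compose)
  then show ?thesis
    by (simp add: newton_def adj_scaleR linear_diff[OF bounded_linear.linear[OF bounded_linear_adj]])
qed

text \<open>
  For \<open>E = 1 - X\<^sup>* X\<close>, the next iterate has defect
  \<open>1 - (1 + E/2) (1 - E) (1 + E/2) = 3/4 E\<^sup>2 + 1/4 E\<^sup>3\<close>.
  Convergence is therefore quadratic as soon as the defect starts below one.
\<close>

lemma almost_isometry_newton:
  assumes X: "almost_isometry q X" and q: "0 \<le> q" "q \<le> 1"
  shows "almost_isometry (q\<^sup>2) (newton X)"
  unfolding almost_isometry_def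
proof
  fix v
  define E where "E = id_blinfun - (adj X o\<^sub>L X)"
  have E: "norm (E v) \<le> q * norm v" for v
    using X by (simp add: almost_isometry_def E_def blinfun.bilinear_simps)
  have "v - adj (newton X) (newton X v) = (3/4) *\<^sub>R E (E v) + (1/4) *\<^sub>R E (E (E v))"
    unfolding adj_newton
    by (rule vector_eq_ldot[THEN iffD1])
      (simp add: newton_def E_def blinfun.bilinear_simps inner_simps field_simps)
  also have "norm \<dots> \<le> (3/4) * norm (E (E v)) + (1/4) * norm (E (E (E v)))"
    by (rule norm_triangle_le) simp
  also have "\<dots> \<le> norm (E (E v))"
  proof -
    have "norm (E (E (E v))) \<le> 1 * norm (E (E v))"
      using E[of "E (E v)"] q mult_right_mono[OF q(2) norm_ge_zero, of "E (E v)"] by linarith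
    then show ?thesis by simp
  qed
  also have "\<dots> \<le> q * (q * norm v)"
    using E[of "E v"] mult_left_mono[OF E[of v] q(1)] by linarith
  finally show "norm (v - adj (newton X) (newton X v)) \<le> q\<^sup>2 * norm v"
    by (simp add: power2_eq_square mult_ac)
qed

text \<open>
  The increment is \<open>X E / 2\<close> with \<open>E = 1 - X\<^sup>* X\<close>, and a defect of at most one forces \<open>\<parallel>X\<parallel> \<le> 2\<close>.
\<close>

lemma norm_newton_diff:
  assumes X: "almost_isometry q X" and q: "0 \<le> q" "q \<le> 1"
  shows "norm (newton X - X) \<le> q"
proof (rule norm_blinfun_bound[OF q(1)])
  fix v
  define w where "w = v - adj X (X v)"
  have w: "norm w \<le> q * norm v" using X by (simp add: almost_isometry_def w_def)
  have "(norm (X u))\<^sup>2 \<le> (2 * norm u)\<^sup>2" for u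
  proof -
    have "(norm (X u))\<^sup>2 = inner u u - inner u (u - adj X (X u))"
      by (simp add: inner_simps power2_norm_eq_inner inner_adj_right)
    also have "\<dots> \<le> (norm u)\<^sup>2 + norm u * norm (u - adj X (X u))"
      using Cauchy_Schwarz_ineq2[of u "u - adj X (X u)"] by (simp add: power2_norm_eq_inner)
    also have "\<dots> \<le> (norm u)\<^sup>2 + norm u * (1 * norm u)"
    proof -
      have "norm (u - adj X (X u)) \<le> 1 * norm u"
        using X q mult_right_mono[OF q(2) norm_ge_zero, of u] unfolding almost_isometry_def
        by (meson order_trans)
      then show ?thesis by (intro add_left_mono mult_left_mono) simp_all
    qed
    also have "\<dots> \<le> (2 * norm u)\<^sup>2" by (simp add: power2_eq_square)
    finally show ?thesis .
  qed
  then have "norm (X w) \<le> 2 * norm w" by (rule power2_le_imp_le) simp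
  moreover have "(newton X - X) v = (1/2) *\<^sub>R X w"
    by (rule vector_eq_ldot[THEN iffD1])
      (simp add: newton_def w_def blinfun.bilinear_simps inner_simps field_simps)
  ultimately show "norm ((newton X - X) v) \<le> q * norm v" using w by simp
qed

text \<open>
  A small multiple of an operator that is bounded below starts the iteration. Expanding
  \<open>\<parallel>v - m\<^sup>2 B\<^sup>* B v\<parallel>\<^sup>2\<close> gives the middle term \<open>-2 m\<^sup>2 \<parallel>B v\<parallel>\<^sup>2 \<le> -2 (m \<parallel>v\<parallel> / K)\<^sup>2\<close>, and
  \<open>m\<^sup>2 = 1 / (K\<^sup>2 M\<^sup>4)\<close> minimises the resulting bound.
\<close>

lemma scaled_almost_isometry:
  fixes B :: "'a::{real_inner, banach} \<Rightarrow>\<^sub>L 'b::{real_inner, banach}" and C :: "'b \<Rightarrow>\<^sub>L 'a"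
  assumes CB: "\<And>v. C (B v) = v" and K: "norm C \<le> K" and M: "norm B \<le> M" and "1 \<le> K" "1 \<le> M"
  defines "m \<equiv> 1 / (K * M\<^sup>2)"
  shows "almost_isometry (sqrt (1 - 1 / (K * M) ^ 4)) (m *\<^sub>R B)"
  unfolding almost_isometry_def
proof
  fix v
  have "norm v = norm (C (B v))" by (simp add: CB)
  also have "\<dots> \<le> K * norm (B v)"
    by (rule order_trans[OF norm_blinfun mult_right_mono[OF K norm_ge_zero]])
  finally have low: "norm v / K \<le> norm (B v)" using \<open>1 \<le> K\<close> by (simp add: field_simps)
  have "1 \<le> K * M" using \<open>1 \<le> K\<close> \<open>1 \<le> M\<close> mult_mono[of 1 K 1 M] by simp
  then have "1 \<le> (K * M) ^ 4" by (rule one_le_power)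
  moreover have "1 / x \<le> 1" if "1 \<le> x" for x :: real using that by simp
  ultimately have KM: "1 / (K * M) ^ 4 \<le> 1" by blast
  have Bv: "norm (B v) \<le> M * norm v"
    by (rule order_trans[OF norm_blinfun mult_right_mono[OF M norm_ge_zero]])
  have "norm (adj B (B v)) \<le> norm (adj B) * norm (B v)" by (rule norm_blinfun)
  also have "\<dots> \<le> M * (M * norm v)"
    using Bv M norm_adj_le[of B] \<open>1 \<le> M\<close> by (intro mult_mono) auto
  finally have up: "norm (adj B (B v)) \<le> M\<^sup>2 * norm v" by (simp add: power2_eq_square)
  have "(norm (v - adj (m *\<^sub>R B) ((m *\<^sub>R B) v)))\<^sup>2
      = (norm v)\<^sup>2 - 2 * m\<^sup>2 * (norm (B v))\<^sup>2 + m ^ 4 * (norm (adj B (B v)))\<^sup>2"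
  proof -
    define w where "w = adj B (B v)"
    have "inner v w = inner (B v) (B v)" by (simp add: w_def inner_adj_right)
    then have "inner (v - m\<^sup>2 *\<^sub>R w) (v - m\<^sup>2 *\<^sub>R w)
        = inner v v - 2 * m\<^sup>2 * inner (B v) (B v) + m ^ 4 * inner w w"
      by (simp add: inner_simps inner_commute[of w v] algebra_simps flip: power_add)
    then show ?thesis
      by (simp add: power2_norm_eq_inner adj_scaleR blinfun.bilinear_simps w_def
          flip: power2_eq_square)
  qed
  also have "\<dots> \<le> (norm v)\<^sup>2 - 2 * m\<^sup>2 * (norm v / K)\<^sup>2 + m ^ 4 * (M\<^sup>2 * norm v)\<^sup>2"
    using low up \<open>1 \<le> K\<close>
    by (intro add_mono diff_mono mult_left_mono power_mono) auto
  also have "\<dots> = (1 - 1 / (K * M) ^ 4) * (norm v)\<^sup>2"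
    using \<open>1 \<le> K\<close> \<open>1 \<le> M\<close> by (simp add: m_def field_simps power_mult_distrib) 
  also have "\<dots> = (sqrt (1 - 1 / (K * M) ^ 4) * norm v)\<^sup>2"
    using KM by (simp only: power_mult_distrib real_sqrt_pow2 diff_ge_0_iff_ge)
  finally show "norm (v - adj (m *\<^sub>R B) ((m *\<^sub>R B) v)) \<le> sqrt (1 - 1 / (K * M) ^ 4) * norm v"
  proof (rule power2_le_imp_le)
    show "0 \<le> sqrt (1 - 1 / (K * M) ^ 4) * norm v"
      using KM by (intro mult_nonneg_nonneg real_sqrt_ge_zero) simp_all
  qed
qed

lemma star_intertwines_newton:
  assumes "star_intertwines X T T'"
  shows "star_intertwines (newton X) T T'"
proof -
  have X: "X (T v) = T' (X v)" "X (adj T v) = adj T' (X v)" for v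
    using assms by (simp_all add: star_intertwines_def)
  have X_adj: "adj X (T' w) = T (adj X w)" "adj X (adj T' w) = adj T (adj X w)" for w
    using star_intertwines_adj[of X T T'] star_intertwines_adj[of X "adj T" "adj T'"] assms
    by (simp_all add: star_intertwines_def)
  show ?thesis
    by (simp add: star_intertwines_def newton_def blinfun.bilinear_simps X X_adj)
qed

text \<open>
  The iterates are controlled together with their adjoints, which are the Newton--Schulz iterates
  of \<open>B\<^sup>*\<close>: the first gives \<open>U\<^sup>* U = 1\<close> in the limit, the second gives \<open>U U\<^sup>* = 1\<close>.
\<close>

lemma unitary_part:
  fixes B :: "'a::{real_inner, banach} \<Rightarrow>\<^sub>L 'b::{real_inner, banach}"
    and C :: "'b \<Rightarrow>\<^sub>L 'a"
  assumes CB: "\<And>v. C (B v) = v" and BC: "\<And>w. B (C w) = w"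
  shows "\<exists>U :: 'a \<Rightarrow>\<^sub>L 'b. (\<forall>v. adj U (U v) = v) \<and> (\<forall>w. U (adj U w) = w) \<and>
    (\<forall>T T'. star_intertwines B T T' \<longrightarrow> star_intertwines U T T')"
proof -
  define K M where "K = norm C + 1" and "M = norm B + 1"
  define m q where "m = 1 / (K * M\<^sup>2)" and "q = sqrt (1 - 1 / (K * M) ^ 4)"
  have KM: "1 \<le> K" "1 \<le> M" by (simp_all add: K_def M_def)
  then have "1 \<le> K * M" using mult_mono[of 1 K 1 M] by simp
  then have "1 \<le> (K * M) ^ 4" by (rule one_le_power)
  moreover have "0 < 1 / x \<and> 1 / x \<le> 1" if "1 \<le> x" for x :: real using that by simp
  ultimately have "0 < 1 / (K * M) ^ 4" "1 / (K * M) ^ 4 \<le> 1" by blast+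
  then have q: "0 \<le> q" "q < 1" by (auto simp: q_def)
  define X where "X n = (newton ^^ n) (m *\<^sub>R B)" for n
  have adjX: "adj (X n) = (newton ^^ n) (m *\<^sub>R adj B)" for n
    by (induction n) (simp_all add: X_def adj_newton adj_scaleR)
  have step: "almost_isometry (q ^ Suc n) ((newton ^^ n) Y)"
    if "almost_isometry q Y" for n and Y :: "'c::{real_inner, banach} \<Rightarrow>\<^sub>L 'd::{real_inner, banach}"
  proof (induction n)
    case (Suc n)
    have "almost_isometry ((q ^ Suc n)\<^sup>2) ((newton ^^ Suc n) Y)"
      using almost_isometry_newton[OF Suc] q by (simp add: power_le_one mult_le_one)
    moreover have "(q ^ Suc n)\<^sup>2 \<le> q ^ Suc (Suc n)"
      using q by (subst power_mult[symmetric], intro power_decreasing) auto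
    ultimately show ?case
      unfolding almost_isometry_def by (meson mult_right_mono norm_ge_zero order_trans)
  qed (use that in simp)
  have iso: "almost_isometry (q ^ Suc n) (X n)" for n
    unfolding X_def m_def
    by (rule step, unfold q_def, rule scaled_almost_isometry[OF CB _ _ KM])
      (simp_all add: K_def M_def)
  have coiso: "almost_isometry (q ^ Suc n) (adj (X n))" for n
    unfolding adjX m_def
  proof (rule step, unfold q_def, rule scaled_almost_isometry[OF _ _ _ KM])
    show "adj C (adj B v) = v" for v
      by (rule vector_eq_rdot[THEN iffD1]) (metis BC inner_adj_left)
  qed (use norm_adj_le[of C] norm_adj_le[of B] in \<open>simp_all add: K_def M_def\<close>)
  have "norm (X (Suc n) - X n) \<le> q ^ n" for n
  proof -
    have "q ^ Suc n \<le> 1" using q by (intro power_le_one) auto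
    then have "norm (newton (X n) - X n) \<le> q ^ Suc n"
      using norm_newton_diff[OF iso[of n]] q by simp
    also have "\<dots> \<le> q ^ n" using q by (intro power_decreasing) auto
    finally show ?thesis by (simp add: X_def)
  qed
  then have "summable (\<lambda>n. X (Suc n) - X n)"
    by (rule summable_comparison_test'[rotated, where N = 0]) (use q in auto)
  then have "convergent (\<lambda>n. X n - X 0)"
    by (simp add: summable_iff_convergent sum_lessThan_telescope)
  then obtain L where "(\<lambda>n. X n - X 0) \<longlonglongrightarrow> L" by (auto simp: convergent_def)
  then have "(\<lambda>n. (X n - X 0) + X 0) \<longlonglongrightarrow> L + X 0" by (intro tendsto_intros)
  then obtain U where U: "X \<longlonglongrightarrow> U" by auto
  have adjU: "(\<lambda>n. adj (X n)) \<longlonglongrightarrow> adj U"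
    by (rule bounded_linear.tendsto[OF bounded_linear_adj U])
  have limit: "adj V (V v) = v"
    if "\<And>n. almost_isometry (q ^ Suc n) (Y n)" "Y \<longlonglongrightarrow> V" "(\<lambda>n. adj (Y n)) \<longlonglongrightarrow> adj V"
    for Y :: "nat \<Rightarrow> 'c::{real_inner, banach} \<Rightarrow>\<^sub>L 'd::{real_inner, banach}" and V v
  proof -
    have "(\<lambda>n. v - adj (Y n) (Y n v)) \<longlonglongrightarrow> v - adj V (V v)"
      by (intro tendsto_intros blinfun.tendsto that)
    moreover have "(\<lambda>n. v - adj (Y n) (Y n v)) \<longlonglongrightarrow> 0"
    proof (rule Lim_null_comparison)
      show "eventually (\<lambda>n. norm (v - adj (Y n) (Y n v)) \<le> q ^ Suc n * norm v) sequentially"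
        using that(1) by (auto simp: almost_isometry_def)
      have "(\<lambda>n. q ^ Suc n) \<longlonglongrightarrow> 0" by (rule LIMSEQ_Suc[OF LIMSEQ_realpow_zero[OF q]])
      then show "(\<lambda>n. q ^ Suc n * norm v) \<longlonglongrightarrow> 0" by (rule tendsto_mult_left_zero)
    qed
    ultimately show ?thesis using LIMSEQ_unique by fastforce
  qed
  have "star_intertwines U T T'" if T: "star_intertwines B T T'" for T T'
  proof -
    have X: "star_intertwines (X n) T T'" for n
    proof (induction n)
      case 0
      show ?case using T by (simp add: X_def star_intertwines_def blinfun.bilinear_simps)
    next
      case (Suc n)
      then show ?case by (simp add: X_def star_intertwines_newton)
    qed
    have pass: "U (R v) = R' (U v)" if "\<And>n. X n (R v) = R' (X n v)"
      for R :: "'a \<Rightarrow>\<^sub>L 'a" and R' :: "'b \<Rightarrow>\<^sub>L 'b" and v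
    proof (rule LIMSEQ_unique)
      show "(\<lambda>n. X n (R v)) \<longlonglongrightarrow> U (R v)" by (intro blinfun.tendsto U tendsto_const)
      show "(\<lambda>n. X n (R v)) \<longlonglongrightarrow> R' (U v)"
        unfolding that by (intro blinfun.tendsto U tendsto_const)
    qed
    show ?thesis using X pass by (simp add: star_intertwines_def)
  qed
  moreover have "adj U (U v) = v" "U (adj U w) = w" for v w
    using limit[of X U v, OF iso U adjU] limit[of "\<lambda>n. adj (X n)" "adj U" w, OF coiso adjU]
    by (simp_all add: U)
  ultimately show ?thesis by blast
qed

section \<open>Rows of partial isometries with orthogonal ranges\<close>

text \<open>
  By Pythagoras, partial sums beyond a finite set that nearly exhausts the total square norm
  differ by little.
\<close>

lemma orthogonal_has_sum:
  fixes f :: "'i \<Rightarrow> 'a::{real_inner, banach}"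
  assumes orth: "pairwise (\<lambda>i j. orthogonal (f i) (f j)) I"
    and bound: "\<And>F. finite F \<Longrightarrow> F \<subseteq> I \<Longrightarrow> (\<Sum>i\<in>F. (norm (f i))\<^sup>2) \<le> c\<^sup>2" and "0 \<le> c"
  shows "(f has_sum infsum f I) I" and "norm (infsum f I) \<le> c"
proof -
  define s where "s F = (\<Sum>i\<in>F. (norm (f i))\<^sup>2)" for F
  have norm_sum: "(norm (sum f F))\<^sup>2 = s F" if "finite F" "F \<subseteq> I" for F
    unfolding s_def using that norm_sum_Pythagorean pairwise_subset[OF orth] by blast
  \<comment> \<open>the total square norm\<close>
  define L where "L = (SUP F\<in>{F. finite F \<and> F \<subseteq> I}. s F)"
  have bdd: "bdd_above (s ` {F. finite F \<and> F \<subseteq> I})"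
    using bound by (auto simp: s_def intro!: bdd_aboveI2[where M = "c\<^sup>2"])
  have s_le: "s F \<le> L" if "finite F" "F \<subseteq> I" for F
    unfolding L_def by (rule cSUP_upper[OF _ bdd]) (use that in auto)
  have "\<exists>P. eventually P (finite_subsets_at_top I) \<and>
      (\<forall>F F'. P F \<and> P F' \<longrightarrow> dist (sum f F) (sum f F') < e)" if "e > 0" for e
  proof -
    have "L - (e/2)\<^sup>2 < L" using \<open>e > 0\<close> by simp
    then obtain F0 where F0: "finite F0" "F0 \<subseteq> I" "L - (e/2)\<^sup>2 < s F0"
      using less_cSUP_iff[OF _ bdd, of "L - (e/2)\<^sup>2"] unfolding L_def by auto
    have close: "dist (sum f F) (sum f F0) < e/2" if "finite F" "F0 \<subseteq> F" "F \<subseteq> I" for F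
    proof (rule power2_less_imp_less)
      have "(dist (sum f F) (sum f F0))\<^sup>2 = (norm (sum f (F - F0)))\<^sup>2"
        using that by (simp add: dist_norm sum_diff)
      also have "\<dots> = s (F - F0)" using that by (intro norm_sum) auto
      also have "\<dots> = s F - s F0" unfolding s_def using that by (simp add: sum_diff)
      finally show "(dist (sum f F) (sum f F0))\<^sup>2 < (e/2)\<^sup>2"
        using F0 s_le[OF that(1,3)] by linarith
    qed (use \<open>e > 0\<close> in simp)
    show ?thesis
    proof (intro exI conjI allI impI)
      show "eventually (\<lambda>F. finite F \<and> F0 \<subseteq> F \<and> F \<subseteq> I) (finite_subsets_at_top I)"
        using F0 by (auto simp: eventually_finite_subsets_at_top)
      show "dist (sum f F) (sum f F') < e"
        if "(finite F \<and> F0 \<subseteq> F \<and> F \<subseteq> I) \<and> finite F' \<and> F0 \<subseteq> F' \<and> F' \<subseteq> I" for F F'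
        using dist_triangle_half_l[OF close close] that by blast
    qed
  qed
  then have "cauchy_filter (filtermap (sum f) (finite_subsets_at_top I))"
    by (simp add: cauchy_filter_metric_filtermap)
  moreover have "complete (UNIV :: 'a set)" by (simp add: complete_UNIV)
  ultimately obtain l where "(sum f \<longlongrightarrow> l) (finite_subsets_at_top I)"
    using complete_uniform[where S = UNIV] by (force simp: filterlim_def)
  then have "f summable_on I" unfolding summable_on_def has_sum_def by blast
  then show sum: "(f has_sum infsum f I) I" by simp
  then have "((\<lambda>F. norm (sum f F)) \<longlongrightarrow> norm (infsum f I)) (finite_subsets_at_top I)"
    unfolding has_sum_def by (rule tendsto_norm)
  moreover have "norm (sum f F) \<le> c" if "finite F" "F \<subseteq> I" for F
    by (rule power2_le_imp_le) (use norm_sum[OF that] bound[OF that] \<open>0 \<le> c\<close> s_def in auto)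
  then have "eventually (\<lambda>F. norm (sum f F) \<le> c) (finite_subsets_at_top I)"
    by (intro eventually_finite_subsets_at_top_weakI)
  ultimately show "norm (infsum f I) \<le> c"
    by (rule tendsto_upperbound) simp
qed

lemma has_sum_single:
  assumes "i \<in> I" "\<And>j. j \<in> I \<Longrightarrow> j \<noteq> i \<Longrightarrow> f j = 0"
  shows "(f has_sum f i) I"
  by (rule has_sum_finite_neutralI[of "{i}"]) (use assms in auto)

text \<open>
  The equation \<open>S S\<^sup>* S = S\<close> is the algebraic form of being a partial isometry.
\<close>

definition isometry_row :: "'e set \<Rightarrow> ('e \<Rightarrow> 'a::{real_inner, banach} \<Rightarrow>\<^sub>L 'a) \<Rightarrow> bool" where
  "isometry_row E S \<longleftrightarrow> (\<forall>e\<in>E. \<forall>v. S e (adj (S e) (S e v)) = S e v) \<and>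
     (\<forall>e\<in>E. \<forall>f\<in>E. e \<noteq> f \<longrightarrow> (\<forall>v. adj (S e) (S f v) = 0))"

lemma isometry_row_simps:
  assumes "isometry_row E S" "e \<in> E"
  shows "S e (adj (S e) (S e v)) = S e v"
    and "adj (S e) (S e (adj (S e) v)) = adj (S e) v"
    and "f \<in> E \<Longrightarrow> e \<noteq> f \<Longrightarrow> adj (S e) (S f v) = 0"
proof -
  show S: "S e (adj (S e) (S e v)) = S e v" for v
    using assms by (simp add: isometry_row_def)
  show "adj (S e) (S e (adj (S e) v)) = adj (S e) v"
  proof (rule vector_eq_rdot[THEN iffD1], rule allI)
    fix z
    have "inner (adj (S e) (S e (adj (S e) v))) z = inner v (S e (adj (S e) (S e z)))"
      by (simp add: inner_adj_left flip: inner_adj_right[of _ "S e"])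
    then show "inner (adj (S e) (S e (adj (S e) v))) z = inner (adj (S e) v) z"
      by (simp add: S inner_adj_left)
  qed
  show "adj (S e) (S f v) = 0" if "f \<in> E" "e \<noteq> f"
    using assms that by (simp add: isometry_row_def)
qed

lemma isometry_row_contraction:
  assumes "isometry_row E S" "e \<in> E"
  shows "norm (S e v) \<le> norm v"
proof (cases "S e v = 0")
  case False
  have "(norm (S e v))\<^sup>2 = inner (adj (S e) (S e v)) v"
    by (simp add: power2_norm_eq_inner inner_adj_left)
  also have "\<dots> \<le> norm (adj (S e) (S e v)) * norm v" by (rule norm_cauchy_schwarz)
  also have "norm (adj (S e) (S e v)) = norm (S e v)"
  proof -
    have "inner (adj (S e) (S e v)) (adj (S e) (S e v)) = inner (S e v) (S e v)"
      using isometry_row_simps(1)[OF assms] by (simp add: inner_adj_left)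
    then show ?thesis by (simp add: norm_eq_sqrt_inner)
  qed
  finally show ?thesis using False by (simp add: power2_eq_square)
qed simp

text \<open>
  This is the expansion of \<open>0 \<le> \<parallel>v - w\<parallel>\<^sup>2\<close> for \<open>w = \<Sum>e\<in>F. S e (S e)\<^sup>* v\<close>, whose summands are orthogonal.
\<close>

lemma isometry_row_bessel:
  assumes S: "isometry_row E S" and F: "finite F" "F \<subseteq> E"
  shows "(\<Sum>e\<in>F. (norm (adj (S e) v))\<^sup>2) \<le> (norm v)\<^sup>2"
proof -
  define w where "w = (\<Sum>e\<in>F. S e (adj (S e) v))"
  have "pairwise (\<lambda>e f. orthogonal (S e (adj (S e) v)) (S f (adj (S f) v))) F"
    using F isometry_row_simps(3)[OF S]
    by (auto simp: pairwise_def orthogonal_def subset_iff simp flip: inner_adj_right)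
  then have "(norm w)\<^sup>2 = (\<Sum>e\<in>F. (norm (S e (adj (S e) v)))\<^sup>2)"
    unfolding w_def by (rule norm_sum_Pythagorean[OF F(1)])
  also have "\<dots> \<le> (\<Sum>e\<in>F. (norm (adj (S e) v))\<^sup>2)"
    using F by (intro sum_mono power_mono isometry_row_contraction[OF S]) auto
  finally have w: "(norm w)\<^sup>2 \<le> (\<Sum>e\<in>F. (norm (adj (S e) v))\<^sup>2)" .
  have "inner v w = (\<Sum>e\<in>F. (norm (adj (S e) v))\<^sup>2)"
    unfolding w_def by (simp add: inner_sum_right power2_norm_eq_inner inner_adj_left)
  moreover have "0 \<le> (norm v)\<^sup>2 - 2 * inner v w + (norm w)\<^sup>2"
    using zero_le_power2[of "norm (v - w)"]
    by (simp add: power2_norm_eq_inner inner_simps inner_commute)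
  ultimately show ?thesis using w by simp
qed

text \<open>
  The operator \<open>\<Sum>e\<in>E. S' e X (S e)\<^sup>*\<close>. For \<open>S = S'\<close> and \<open>X = 1\<close> it is the projection onto the
  closed span of the ranges of the row, and iterating it sums over all words of a given length.
\<close>

definition ampl :: "'e set \<Rightarrow> ('e \<Rightarrow> 'a::{real_inner, banach} \<Rightarrow>\<^sub>L 'a) \<Rightarrow>
    ('e \<Rightarrow> 'b::{real_inner, banach} \<Rightarrow>\<^sub>L 'b) \<Rightarrow> ('a \<Rightarrow>\<^sub>L 'b) \<Rightarrow> 'a \<Rightarrow>\<^sub>L 'b" where
  "ampl E S S' X = Blinfun (\<lambda>v. \<Sum>\<^sub>\<infinity>e\<in>E. S' e (X (adj (S e) v)))"

lemma
  fixes X :: "'a::{real_inner, banach} \<Rightarrow>\<^sub>L 'b::{real_inner, banach}"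
  assumes S: "isometry_row E S" and S': "isometry_row E S'"
  shows ampl_has_sum: "((\<lambda>e. S' e (X (adj (S e) v))) has_sum ampl E S S' X v) E"
    and norm_ampl_apply: "norm (ampl E S S' X v) \<le> norm X * norm v"
proof -
  define g where "g v e = S' e (X (adj (S e) v))" for v e
  have orth: "pairwise (\<lambda>e f. orthogonal (g v e) (g v f)) E" for v
    using isometry_row_simps(3)[OF S']
    by (auto simp: pairwise_def orthogonal_def g_def simp flip: inner_adj_left)
  have bound: "(\<Sum>e\<in>F. (norm (g v e))\<^sup>2) \<le> (norm X * norm v)\<^sup>2"
    if "finite F" "F \<subseteq> E" for F v
  proof -
    have "(\<Sum>e\<in>F. (norm (g v e))\<^sup>2) \<le> (\<Sum>e\<in>F. (norm X * norm (adj (S e) v))\<^sup>2)"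
      unfolding g_def using that
      by (intro sum_mono power_mono order_trans[OF isometry_row_contraction[OF S'] norm_blinfun]) auto
    also have "\<dots> = (norm X)\<^sup>2 * (\<Sum>e\<in>F. (norm (adj (S e) v))\<^sup>2)"
      by (simp add: power_mult_distrib sum_distrib_left)
    also have "\<dots> \<le> (norm X)\<^sup>2 * (norm v)\<^sup>2"
      by (intro mult_left_mono isometry_row_bessel[OF S that]) simp
    finally show ?thesis by (simp add: power_mult_distrib)
  qed
  have sum: "(g v has_sum infsum (g v) E) E" for v
    by (rule orthogonal_has_sum(1)[OF orth bound]) auto
  have norm: "norm (infsum (g v) E) \<le> norm X * norm v" for v
    by (rule orthogonal_has_sum(2)[OF orth bound]) auto
  have "bounded_linear (\<lambda>v. infsum (g v) E)"
  proof (rule bounded_linear_intro)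
    show "infsum (g (u + v)) E = infsum (g u) E + infsum (g v) E" for u v
    proof (rule infsumI)
      show "(g (u + v) has_sum infsum (g u) E + infsum (g v) E) E"
        using has_sum_add[OF sum[of u] sum[of v]] by (simp add: g_def[abs_def] blinfun.bilinear_simps)
    qed
    show "infsum (g (r *\<^sub>R v)) E = r *\<^sub>R infsum (g v) E" for r v
    proof (rule infsumI)
      show "(g (r *\<^sub>R v) has_sum r *\<^sub>R infsum (g v) E) E"
        using has_sum_scaleR[OF sum[of v], of r] by (simp add: g_def[abs_def] blinfun.bilinear_simps)
    qed
    show "norm (infsum (g v) E) \<le> norm v * norm X" for v
      using norm[of v] by (simp add: mult.commute)
  qed
  then have ampl: "ampl E S S' X v = infsum (g v) E" for v
    by (simp add: ampl_def g_def[abs_def] bounded_linear_Blinfun_apply)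
  show "((\<lambda>e. S' e (X (adj (S e) v))) has_sum ampl E S S' X v) E"
    using sum[of v] unfolding ampl by (simp add: g_def[abs_def])
  show "norm (ampl E S S' X v) \<le> norm X * norm v" unfolding ampl by (rule norm)
qed

lemma ampl_eqI:
  fixes X :: "'a::{real_inner, banach} \<Rightarrow>\<^sub>L 'b::{real_inner, banach}"
  assumes "isometry_row E S" "isometry_row E S'"
    and "((\<lambda>e. S' e (X (adj (S e) v))) has_sum w) E"
  shows "ampl E S S' X v = w"
  using has_sum_unique[OF ampl_has_sum[OF assms(1,2)] assms(3)] .

lemma ampl_diff:
  fixes X :: "'a::{real_inner, banach} \<Rightarrow>\<^sub>L 'b::{real_inner, banach}" and Y :: "'a \<Rightarrow>\<^sub>L 'b"
  assumes "isometry_row E S" "isometry_row E S'"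
  shows "ampl E S S' (X - Y) v = ampl E S S' X v - ampl E S S' Y v"
proof (rule ampl_eqI[OF assms])
  have "((\<lambda>e. - S' e (Y (adj (S e) v))) has_sum - ampl E S S' Y v) E"
    using has_sum_scaleR[OF ampl_has_sum[OF assms], of "-1"] by simp
  from has_sum_add[OF ampl_has_sum[OF assms] this]
  show "((\<lambda>e. S' e ((X - Y) (adj (S e) v))) has_sum ampl E S S' X v - ampl E S S' Y v) E"
    by (simp add: blinfun.bilinear_simps)
qed

lemma adj_ampl:
  fixes X :: "'a::{real_inner, banach} \<Rightarrow>\<^sub>L 'b::{real_inner, banach}"
  assumes "isometry_row E S" "isometry_row E S'"
  shows "adj (ampl E S S' X) = ampl E S' S (adj X)"
proof (rule adj_eqI)
  fix v w
  have "((\<lambda>e. inner (S' e (X (adj (S e) v))) w) has_sum inner (ampl E S S' X v) w) E"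
    by (rule has_sum_bounded_linear[OF bounded_linear_inner_left ampl_has_sum[OF assms]])
  moreover have "((\<lambda>e. inner v (S e (adj X (adj (S' e) w)))) has_sum
      inner v (ampl E S' S (adj X) w)) E"
    by (rule has_sum_bounded_linear[OF bounded_linear_inner_right ampl_has_sum[OF assms(2,1)]])
  moreover have "inner (S' e (X (adj (S e) v))) w = inner v (S e (adj X (adj (S' e) w)))" for e
    by (simp add: inner_adj_right inner_adj_left flip: inner_adj_left[of "S e"])
  ultimately show "inner (ampl E S S' X v) w = inner v (ampl E S' S (adj X) w)"
    using has_sum_unique by fastforce
qed

lemma ampl_commute:
  fixes X :: "'a::{real_inner, banach} \<Rightarrow>\<^sub>L 'b::{real_inner, banach}" and D :: "'a \<Rightarrow>\<^sub>L 'a" and D' :: "'b \<Rightarrow>\<^sub>L 'b"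
  assumes "isometry_row E S" "isometry_row E S'"
    and "\<And>e. e \<in> E \<Longrightarrow> S' e (X (adj (S e) (D v))) = D' (S' e (X (adj (S e) v)))"
  shows "ampl E S S' X (D v) = blinfun_apply D' (ampl E S S' X v)"
proof (rule ampl_eqI[OF assms(1,2)])
  have "((\<lambda>e. D' (S' e (X (adj (S e) v)))) has_sum D' (ampl E S S' X v)) E"
    by (rule has_sum_bounded_linear[OF blinfun.bounded_linear_right ampl_has_sum[OF assms(1,2)]])
  then show "((\<lambda>e. S' e (X (adj (S e) (D v)))) has_sum D' (ampl E S S' X v)) E"
    by (subst has_sum_cong) (use assms(3) in auto)
qed

text \<open>
  Compatibility with the initial projections \<open>(S e)\<^sup>* S e\<close> is the condition under which
  \<^const>\<open>ampl\<close> is functorial (\<open>ampl_compose\<close>): the factor \<open>(S' e)\<^sup>* S' e\<close> that appears in a composite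
  passes through \<open>X\<close> and is absorbed by \<open>(S e)\<^sup>*\<close>.
\<close>

definition initial_intertwiner :: "'e set \<Rightarrow> ('e \<Rightarrow> 'a::{real_inner, banach} \<Rightarrow>\<^sub>L 'a) \<Rightarrow>
    ('e \<Rightarrow> 'b::{real_inner, banach} \<Rightarrow>\<^sub>L 'b) \<Rightarrow> ('a \<Rightarrow>\<^sub>L 'b) \<Rightarrow> bool" where
  "initial_intertwiner E S S' X \<longleftrightarrow>
     (\<forall>e\<in>E. \<forall>v. X (adj (S e) (S e v)) = adj (S' e) (S' e (X v)))"

lemma ampl_row:
  fixes X :: "'a::{real_inner, banach} \<Rightarrow>\<^sub>L 'b::{real_inner, banach}"
  assumes S: "isometry_row E S" and S': "isometry_row E S'"
    and X: "initial_intertwiner E S S' X" and e: "e \<in> E"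
  shows "ampl E S S' X (S e v) = S' e (X v)"
proof (rule ampl_eqI[OF S S'])
  have "((\<lambda>f. S' f (X (adj (S f) (S e v)))) has_sum S' e (X (adj (S e) (S e v)))) E"
    by (rule has_sum_single[OF e]) (use isometry_row_simps(3)[OF S _ e] in auto)
  moreover have "S' e (X (adj (S e) (S e v))) = S' e (X v)"
    using X e isometry_row_simps(1)[OF S' e] by (simp add: initial_intertwiner_def)
  ultimately show "((\<lambda>f. S' f (X (adj (S f) (S e v)))) has_sum S' e (X v)) E" by simp
qed

lemma adj_row_ampl:
  fixes X :: "'a::{real_inner, banach} \<Rightarrow>\<^sub>L 'b::{real_inner, banach}"
  assumes S: "isometry_row E S" and S': "isometry_row E S'"
    and X: "initial_intertwiner E S S' X" and e: "e \<in> E"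
  shows "adj (S' e) (ampl E S S' X v) = X (adj (S e) v)"
proof (rule has_sum_unique)
  show "((\<lambda>f. adj (S' e) (S' f (X (adj (S f) v)))) has_sum adj (S' e) (ampl E S S' X v)) E"
    by (rule has_sum_bounded_linear[OF blinfun.bounded_linear_right ampl_has_sum[OF S S']])
  have "((\<lambda>f. adj (S' e) (S' f (X (adj (S f) v)))) has_sum
      adj (S' e) (S' e (X (adj (S e) v)))) E"
    by (rule has_sum_single[OF e]) (use isometry_row_simps(3)[OF S' e] in auto)
  moreover have "adj (S' e) (S' e (X (adj (S e) v))) = X (adj (S e) v)"
    using X e isometry_row_simps(2)[OF S e, of v] by (metis initial_intertwiner_def)
  ultimately show "((\<lambda>f. adj (S' e) (S' f (X (adj (S f) v)))) has_sum X (adj (S e) v)) E"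
    by simp
qed

lemma ampl_compose:
  fixes X :: "'a::{real_inner, banach} \<Rightarrow>\<^sub>L 'b::{real_inner, banach}"
    and Y :: "'b \<Rightarrow>\<^sub>L 'c::{real_inner, banach}"
  assumes S: "isometry_row E S" and S': "isometry_row E S'" and S'': "isometry_row E S''"
    and X: "initial_intertwiner E S S' X"
  shows "ampl E S' S'' Y (ampl E S S' X v) = ampl E S S'' (Y o\<^sub>L X) v"
proof (rule sym, rule ampl_eqI[OF S S''])
  have "((\<lambda>e. S'' e (Y (adj (S' e) (ampl E S S' X v)))) has_sum
      ampl E S' S'' Y (ampl E S S' X v)) E"
    by (rule ampl_has_sum[OF S' S''])
  then show "((\<lambda>e. S'' e ((Y o\<^sub>L X) (adj (S e) v))) has_sum
      ampl E S' S'' Y (ampl E S S' X v)) E"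
    by (subst (asm) has_sum_cong[where g = "\<lambda>e. S'' e ((Y o\<^sub>L X) (adj (S e) v))"])
      (use adj_row_ampl[OF S S' X] in auto)
qed

lemma initial_intertwiner_id: "initial_intertwiner E S S id_blinfun"
  by (simp add: initial_intertwiner_def)

section \<open>From a similarity to one that respects adjoints\<close>

lemma ampl_id_fixes_ampl:
  fixes X :: "'a::{real_inner, banach} \<Rightarrow>\<^sub>L 'b::{real_inner, banach}"
  assumes S: "isometry_row E S" and S': "isometry_row E S'" and X: "initial_intertwiner E S S' X"
  shows "ampl E S' S' id_blinfun (ampl E S S' X v) = ampl E S S' X v"
    and "ampl E S S' X (ampl E S S id_blinfun v) = ampl E S S' X v"
proof -
  have "id_blinfun o\<^sub>L X = X" "X o\<^sub>L id_blinfun = X" by (auto intro: blinfun_eqI)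
  then show "ampl E S' S' id_blinfun (ampl E S S' X v) = ampl E S S' X v"
    and "ampl E S S' X (ampl E S S id_blinfun v) = ampl E S S' X v"
    using ampl_compose[OF S S' S' X, of id_blinfun v]
      ampl_compose[OF S S S' initial_intertwiner_id, of X v] by simp_all
qed

text \<open>
  \<open>R\<close> is an orthogonal projection, so this is Pythagoras.
\<close>

lemma norm_split_ampl_id:
  assumes S: "isometry_row E S"
  defines "R \<equiv> ampl E S S id_blinfun"
  shows "(norm (v - R v + R w))\<^sup>2 = (norm (v - R v))\<^sup>2 + (norm (R w))\<^sup>2"
proof -
  have "adj R = R" unfolding R_def by (simp add: adj_ampl[OF S S])
  then have "inner (v - R v) (R w) = inner (R (v - R v)) w"
    using inner_adj_right[of "v - R v" R w] by simp
  also have "R (v - R v) = 0"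
    unfolding R_def
    by (simp add: blinfun.bilinear_simps ampl_id_fixes_ampl[OF S S initial_intertwiner_id])
  finally show ?thesis
    by (simp only: power2_norm_eq_inner inner_add_left inner_add_right inner_commute) simp
qed

text \<open>
  Let \<open>R\<close> and \<open>R'\<close> be the range projections of the two rows. A similarity \<open>A\<close> maps the range of \<open>R\<close>
  onto the range of \<open>R'\<close>, so it is block triangular for these decompositions, with the block
  \<open>(1 - R') A (1 - R) = (1 - R') A\<close> on the complements. The step keeps this block, discards the
  off-diagonal one, and puts the amplification of \<open>X\<close> on the ranges. A fixed point \<open>B\<close> that is
  compatible with the initial projections satisfies
  \<open>B S e = S' e B\<close> and \<open>(S' e)\<^sup>* B = B (S e)\<^sup>*\<close>.
\<close>

definition diagonal_step :: "'e set \<Rightarrow> ('e \<Rightarrow> 'a::{real_inner, banach} \<Rightarrow>\<^sub>L 'a) \<Rightarrow>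
    ('e \<Rightarrow> 'b::{real_inner, banach} \<Rightarrow>\<^sub>L 'b) \<Rightarrow> ('a \<Rightarrow>\<^sub>L 'b) \<Rightarrow> ('a \<Rightarrow>\<^sub>L 'b) \<Rightarrow> 'a \<Rightarrow>\<^sub>L 'b" where
  "diagonal_step E S S' A X = A - (ampl E S' S' id_blinfun o\<^sub>L A) + ampl E S S' X"

definition intertwines :: "(('a::{real_inner, banach} \<Rightarrow>\<^sub>L 'a) \<times> ('b::{real_inner, banach} \<Rightarrow>\<^sub>L 'b)) set \<Rightarrow>
    ('a \<Rightarrow>\<^sub>L 'b) \<Rightarrow> bool" where
  "intertwines M X \<longleftrightarrow> (\<forall>D D'. (D, D') \<in> M \<longrightarrow> (\<forall>v. X (D v) = D' (X v)))"

lemma strong_limit: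
  fixes X :: "nat \<Rightarrow> 'a::real_normed_vector \<Rightarrow>\<^sub>L 'b::real_normed_vector"
  assumes conv: "\<And>v. convergent (\<lambda>n. X n v)" and bound: "\<And>n. norm (X n) \<le> K"
  shows "\<exists>B :: 'a \<Rightarrow>\<^sub>L 'b. \<forall>v. (\<lambda>n. X n v) \<longlonglongrightarrow> B v"
proof -
  obtain h where h: "\<And>v. (\<lambda>n. X n v) \<longlonglongrightarrow> h v"
    using conv unfolding convergent_def by metis
  have "bounded_linear h"
  proof (rule bounded_linear_intro)
    show "h (u + v) = h u + h v" for u v
      by (rule LIMSEQ_unique[OF h])
        (use tendsto_add[OF h[of u] h[of v]] in \<open>simp add: blinfun.bilinear_simps\<close>)
    show "h (r *\<^sub>R v) = r *\<^sub>R h v" for r v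
      by (rule LIMSEQ_unique[OF h])
        (use tendsto_scaleR[OF tendsto_const h[of v]] in \<open>simp add: blinfun.bilinear_simps\<close>)
    show "norm (h v) \<le> norm v * K" for v
    proof (rule LIMSEQ_le_const2[OF tendsto_norm[OF h]])
      have "norm (X n v) \<le> norm v * K" for n
        using norm_blinfun[of "X n" v] mult_right_mono[OF bound[of n] norm_ge_zero, of v]
        by (simp add: mult.commute)
      then show "\<exists>N. \<forall>n\<ge>N. norm (X n v) \<le> norm v * K" by blast
    qed
  qed
  then show ?thesis using h by (intro exI[of _ "Blinfun h"]) (simp add: bounded_linear_Blinfun_apply)
qed

lemma strong_limit_inverse:
  fixes X :: "nat \<Rightarrow> 'a::real_normed_vector \<Rightarrow>\<^sub>L 'b::real_normed_vector"
    and Y :: "nat \<Rightarrow> 'b \<Rightarrow>\<^sub>L 'a" and B :: "'a \<Rightarrow>\<^sub>L 'b" and C :: "'b \<Rightarrow>\<^sub>L 'a"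
  assumes B: "\<And>v. (\<lambda>n. X n v) \<longlonglongrightarrow> B v" and C: "\<And>w. (\<lambda>n. Y n w) \<longlonglongrightarrow> C w"
    and bound: "\<And>n. norm (Y n) \<le> K" and inv: "\<And>n v. Y n (X n v) = v"
  shows "C (B v) = v"
proof (rule LIMSEQ_unique[OF C])
  have "(\<lambda>n. Y n (B v - X n v)) \<longlonglongrightarrow> 0"
  proof (rule Lim_null_comparison)
    have "norm (Y n (B v - X n v)) \<le> K * norm (B v - X n v)" for n
      by (rule order_trans[OF norm_blinfun mult_right_mono[OF bound norm_ge_zero]])
    then show "eventually (\<lambda>n. norm (Y n (B v - X n v)) \<le> K * norm (B v - X n v)) sequentially"
      by simp
    show "(\<lambda>n. K * norm (B v - X n v)) \<longlonglongrightarrow> 0"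
      using tendsto_mult[OF tendsto_const tendsto_norm[OF tendsto_diff[OF tendsto_const B[of v]]], of K "B v"]
      by simp
  qed
  then have "(\<lambda>n. Y n (B v - X n v) + v) \<longlonglongrightarrow> 0 + v" by (intro tendsto_intros)
  then show "(\<lambda>n. Y n (B v)) \<longlonglongrightarrow> v" by (simp add: blinfun.bilinear_simps inv)
qed

text \<open>
  The relation \<open>M\<close> pairs coefficient operators for the first row with those for the second. Each
  row behaves like a bimodule over its coefficients: a coefficient on the left of \<open>S e\<close> can be moved
  to the right at the price of replacing it by another one. For a graph, \<open>M\<close> will consist of the vertex
  projections and the complex scalars, so that intertwining \<open>M\<close> covers complex linearity and
  the vertex relations by one argument.
\<close>

locale similar_rows =
  fixes E :: "'e set"
    and S :: "'e \<Rightarrow> 'a::{real_inner, banach} \<Rightarrow>\<^sub>L 'a"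
    and S' :: "'e \<Rightarrow> 'b::{real_inner, banach} \<Rightarrow>\<^sub>L 'b"
    and M :: "(('a \<Rightarrow>\<^sub>L 'a) \<times> ('b \<Rightarrow>\<^sub>L 'b)) set"
    and A :: "'a \<Rightarrow>\<^sub>L 'b" and C :: "'b \<Rightarrow>\<^sub>L 'a"
  assumes S: "isometry_row E S" and S': "isometry_row E S'"
    and C_A: "\<And>v. C (A v) = v" and A_C: "\<And>w. A (C w) = w"
    and A_S: "\<And>e v. e \<in> E \<Longrightarrow> A (S e v) = S' e (A v)"
    and A_M: "intertwines M A"
    and M_initial: "\<And>e. e \<in> E \<Longrightarrow> (adj (S e) o\<^sub>L S e, adj (S' e) o\<^sub>L S' e) \<in> M"
    and M_row: "\<And>D D' e. (D, D') \<in> M \<Longrightarrow> e \<in> E \<Longrightarrow> \<exists>F F'. (F, F') \<in> M \<and>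
      (\<forall>v. D (S e v) = S e (F v)) \<and> (\<forall>v. adj (S e) (D v) = F (adj (S e) v)) \<and>
      (\<forall>w. D' (S' e w) = S' e (F' w)) \<and> (\<forall>w. adj (S' e) (D' w) = F' (adj (S' e) w))"
begin

text \<open>
  All hypotheses are symmetric, so every result about \<open>A\<close> also holds for its inverse \<open>C\<close>.
\<close>

lemma swap: "similar_rows E S' S (M\<inverse>) C A"
proof
  show "C (S' e w) = S e (C w)" if "e \<in> E" for e w
    by (metis A_C C_A A_S[OF that])
  have "C (D' w) = D (C w)" if "(D, D') \<in> M" for D D' w
  proof -
    have "A (D (C w)) = D' (A (C w))" using A_M that by (auto simp: intertwines_def)
    then have "C (D' (A (C w))) = C (A (D (C w)))" by simp
    then show ?thesis by (simp only: A_C C_A)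
  qed
  then show "intertwines (M\<inverse>) C" by (auto simp: intertwines_def)
  show "\<exists>F F'. (F, F') \<in> M\<inverse> \<and> (\<forall>v. D (S' e v) = S' e (F v)) \<and>
      (\<forall>v. adj (S' e) (D v) = F (adj (S' e) v)) \<and>
      (\<forall>w. D' (S e w) = S e (F' w)) \<and> (\<forall>w. adj (S e) (D' w) = F' (adj (S e) w))"
    if "(D, D') \<in> M\<inverse>" "e \<in> E" for D D' e
    using M_row[of D' D e] that by blast
qed (use S S' C_A A_C M_initial in auto)

abbreviation "R \<equiv> ampl E S S id_blinfun"
abbreviation "R' \<equiv> ampl E S' S' id_blinfun"

lemma initial_intertwinerI:
  assumes "intertwines M X"
  shows "initial_intertwiner E S S' X"
  using assms M_initial unfolding initial_intertwiner_def intertwines_def by fastforce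

lemma ampl_similarity: "ampl E S S' A v = A (R v)"
proof (rule ampl_eqI[OF S S'])
  have "((\<lambda>e. A (S e (adj (S e) v))) has_sum A (R v)) E"
    using has_sum_bounded_linear[OF blinfun.bounded_linear_right ampl_has_sum[OF S S, of id_blinfun v], of A]
    by simp
  then show "((\<lambda>e. S' e (A (adj (S e) v))) has_sum A (R v)) E"
    by (subst has_sum_cong[where g = "\<lambda>e. A (S e (adj (S e) v))"]) (use A_S in auto)
qed

text \<open>
  Block triangularity of \<open>A\<close>.
\<close>

lemma R'_A_R: "R' (A (R v)) = A (R v)"
  using ampl_id_fixes_ampl(1)[OF S S' initial_intertwinerI[OF A_M]] by (simp add: ampl_similarity)

lemma intertwines_step:
  assumes X: "intertwines M X"
  shows "intertwines M (diagonal_step E S S' A X)"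
  unfolding intertwines_def
proof (safe)
  fix D D' v assume D: "(D, D') \<in> M"
  have "R' (D' w) = D' (R' w)" for w
  proof (rule ampl_commute[OF S' S'])
    fix e assume "e \<in> E"
    from M_row[OF D this] show "S' e (id_blinfun (adj (S' e) (D' w))) = D' (S' e (id_blinfun (adj (S' e) w)))"
      by auto
  qed
  moreover have "ampl E S S' X (D v) = D' (ampl E S S' X v)"
  proof (rule ampl_commute[OF S S'])
    fix e assume "e \<in> E"
    from M_row[OF D this] obtain F F' where F: "(F, F') \<in> M"
      "\<And>v. adj (S e) (D v) = F (adj (S e) v)" "\<And>w. D' (S' e w) = S' e (F' w)" by blast
    then show "S' e (X (adj (S e) (D v))) = D' (S' e (X (adj (S e) v)))"
      using X by (auto simp: intertwines_def)
  qed
  moreover have "A (D v) = D' (A v)" using A_M D by (auto simp: intertwines_def)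
  ultimately show "diagonal_step E S S' A X (D v) = D' (diagonal_step E S S' A X v)"
    by (simp add: diagonal_step_def blinfun.bilinear_simps)
qed

text \<open>
  Both blocks are bounded by \<open>\<parallel>A\<parallel>\<close>, and a block diagonal operator is bounded by the larger of its blocks.
\<close>

lemma norm_step:
  assumes X: "intertwines M X" "norm X \<le> norm A"
  shows "norm (diagonal_step E S S' A X) \<le> norm A"
proof (rule norm_blinfun_bound)
  fix v
  define u where "u = v - R v"
  have R'_ampl: "R' (ampl E S S' X v) = ampl E S S' X v"
    by (rule ampl_id_fixes_ampl[OF S S' initial_intertwinerI[OF X(1)]])
  have Au: "A v - R' (A v) = A u - R' (A u)"
    by (simp add: u_def blinfun.bilinear_simps R'_A_R)
  have "(norm (diagonal_step E S S' A X v))\<^sup>2 = (norm (A u - R' (A u)))\<^sup>2 + (norm (ampl E S S' X v))\<^sup>2"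
    using norm_split_ampl_id[OF S', of "A u" "ampl E S S' X v"]
    by (simp add: diagonal_step_def blinfun.bilinear_simps R'_ampl Au)
  also have "\<dots> \<le> (norm A * norm u)\<^sup>2 + (norm A * norm (R v))\<^sup>2"
  proof (intro add_mono power_mono)
    have "(norm (A u - R' (A u)))\<^sup>2 \<le> (norm (A u))\<^sup>2"
      using norm_split_ampl_id[OF S', of "A u" "A u"] by simp
    then have "norm (A u - R' (A u)) \<le> norm (A u)" by (rule power2_le_imp_le) simp
    then show "norm (A u - R' (A u)) \<le> norm A * norm u"
      using norm_blinfun[of A u] by (rule order_trans)
    have "norm (ampl E S S' X (R v)) \<le> norm X * norm (R v)"
      by (rule norm_ampl_apply[OF S S'])
    also have "\<dots> \<le> norm A * norm (R v)" using X(2) by (rule mult_right_mono) simp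
    finally show "norm (ampl E S S' X v) \<le> norm A * norm (R v)"
      by (simp add: ampl_id_fixes_ampl(2)[OF S S' initial_intertwinerI[OF X(1)]])
  qed simp_all
  also have "\<dots> = (norm A * norm v)\<^sup>2"
    using norm_split_ampl_id[OF S, of v v]
    by (simp add: power_mult_distrib u_def flip: distrib_left)
  finally show "norm (diagonal_step E S S' A X v) \<le> norm A * norm v"
    by (rule power2_le_imp_le) simp
qed simp

lemma step_row:
  assumes X: "intertwines M X" and e: "e \<in> E"
  shows "diagonal_step E S S' A X (S e v) = S' e (X v)"
    and "adj (S' e) (diagonal_step E S S' A X v) = X (adj (S e) v)"
proof -
  note int = initial_intertwinerI[OF X] and id = initial_intertwiner_id
  show "diagonal_step E S S' A X (S e v) = S' e (X v)"
    by (simp add: diagonal_step_def blinfun.bilinear_simps A_S[OF e] ampl_row[OF S S' int e]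
        ampl_row[OF S' S' id e])
  show "adj (S' e) (diagonal_step E S S' A X v) = X (adj (S e) v)"
    by (simp add: diagonal_step_def blinfun.bilinear_simps adj_row_ampl[OF S S' int e]
        adj_row_ampl[OF S' S' id e])
qed

text \<open>
  Blockwise: on the ranges, functoriality of the amplification turns \<open>Y X = 1\<close> into \<open>R\<close>; on the
  complements, the diagonal blocks of the mutually inverse triangular operators \<open>A\<close> and \<open>C\<close> are
  inverse to each other.
\<close>

lemma step_inverse:
  fixes Y :: "'b \<Rightarrow>\<^sub>L 'a"
  assumes X: "intertwines M X" and YX: "\<And>v. Y (X v) = v"
  shows "diagonal_step E S' S C Y (diagonal_step E S S' A X v) = v"
proof -
  interpret swap: similar_rows E S' S "M\<inverse>" C A by (rule swap)
  note int = initial_intertwinerI[OF X] and id = initial_intertwiner_id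
  define a b where "a = A v - R' (A v)" and "b = ampl E S S' X v"
  have R'b: "R' b = b" unfolding b_def by (rule ampl_id_fixes_ampl(1)[OF S S' int])
  have "R (C b) = C b" using swap.R'_A_R[of b] by (simp add: R'b)
  moreover have "C a - R (C a) = v - R v"
    by (simp add: a_def blinfun.bilinear_simps C_A swap.R'_A_R)
  moreover have "ampl E S' S Y a = 0"
  proof -
    have "Y o\<^sub>L id_blinfun = Y" by (auto intro: blinfun_eqI)
    then have "ampl E S' S Y (R' (A v)) = ampl E S' S Y (A v)"
      using ampl_compose[OF S' S' S id, of Y "A v"] by simp
    then show ?thesis by (simp add: a_def blinfun.bilinear_simps)
  qed
  moreover have "ampl E S' S Y b = R v"
  proof -
    have "Y o\<^sub>L X = id_blinfun" by (auto intro: blinfun_eqI simp: YX)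
    then show ?thesis unfolding b_def by (simp add: ampl_compose[OF S S' S int])
  qed
  ultimately show ?thesis
    by (simp add: diagonal_step_def blinfun.bilinear_simps flip: a_def b_def)
qed

text \<open>
  The \<open>n\<close>-th approximant is diagonal with respect to the first \<open>n\<close> generations of wandering subspaces
  and still equals \<open>A\<close> on the span of the ranges of all words of length \<open>n\<close>.
\<close>

definition approximant :: "nat \<Rightarrow> 'a \<Rightarrow>\<^sub>L 'b" where
  "approximant n = (diagonal_step E S S' A ^^ n) A"

lemma approximant_Suc: "approximant (Suc n) = diagonal_step E S S' A (approximant n)"
  by (simp add: approximant_def)

lemma approximant_intertwines: "intertwines M (approximant n)"
  by (induction n) (simp_all add: approximant_def A_M intertwines_step)

lemma norm_approximant: "norm (approximant n) \<le> norm A"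
proof (induction n)
  case (Suc n)
  then show ?case using norm_step[OF approximant_intertwines] by (simp add: approximant_Suc)
qed (simp add: approximant_def)

text \<open>
  The projection onto the closed span of the ranges of all words of length \<open>n\<close>. These subspaces
  decrease to the part on which the row is coisometric in the Wold decomposition.
\<close>

definition tail_proj :: "nat \<Rightarrow> 'a \<Rightarrow>\<^sub>L 'a" where
  "tail_proj n = (ampl E S S ^^ n) id_blinfun"

lemma tail_proj_Suc: "tail_proj (Suc n) = ampl E S S (tail_proj n)"
  by (simp add: tail_proj_def)

lemma tail_proj_initial: "initial_intertwiner E S S (tail_proj n)"
proof -
  have "tail_proj n (D v) = D (tail_proj n v)" if "(D, D') \<in> M" for D D' v
    using that
  proof (induction n arbitrary: D D' v)
    case (Suc n)
    have "ampl E S S (tail_proj n) (D v) = D (ampl E S S (tail_proj n) v)"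
    proof (rule ampl_commute[OF S S])
      fix e assume "e \<in> E"
      from M_row[OF Suc.prems this] obtain F F' where "(F, F') \<in> M"
        "\<And>v. adj (S e) (D v) = F (adj (S e) v)" "\<And>v. D (S e v) = S e (F v)" by blast
      then show "S e (tail_proj n (adj (S e) (D v))) = D (S e (tail_proj n (adj (S e) v)))"
        using Suc.IH by simp
    qed
    then show ?case by (simp add: tail_proj_Suc)
  qed (simp add: tail_proj_def)
  then show ?thesis using M_initial by (fastforce simp: initial_intertwiner_def)
qed

lemma adj_tail_proj: "adj (tail_proj n) = tail_proj n"
  by (induction n) (simp_all add: tail_proj_def adj_ampl[OF S S])

lemma tail_proj_decreasing: "m \<le> n \<Longrightarrow> tail_proj m (tail_proj n v) = tail_proj n v"
proof (induction m arbitrary: n v)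
  case (Suc m)
  then obtain k where n: "n = Suc k" "m \<le> k" by (cases n) auto
  have "tail_proj m o\<^sub>L tail_proj k = tail_proj k"
    by (rule blinfun_eqI) (simp add: Suc.IH n)
  then show ?case
    using ampl_compose[OF S S S tail_proj_initial, of "tail_proj m" k v]
    by (simp add: n tail_proj_Suc)
qed (simp add: tail_proj_def)

text \<open>
  For decreasing projections, \<open>\<parallel>Z m v - Z n v\<parallel>\<^sup>2 = \<parallel>Z m v\<parallel>\<^sup>2 - \<parallel>Z n v\<parallel>\<^sup>2\<close> when \<open>m \<le> n\<close>,
  and the square norms form a bounded decreasing sequence.
\<close>

lemma tail_proj_Cauchy: "Cauchy (\<lambda>n. tail_proj n v)"
proof -
  define a where "a n = (norm (tail_proj n v))\<^sup>2" for n
  have diff: "(norm (tail_proj m v - tail_proj n v))\<^sup>2 = a m - a n" if "m \<le> n" for m n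
  proof -
    have "inner (tail_proj m v) (tail_proj n v) = inner (tail_proj n v) (tail_proj n v)"
      using inner_adj_left[of "tail_proj m" v "tail_proj n v"]
        inner_adj_left[of "tail_proj n" v "tail_proj n v"]
      by (simp add: adj_tail_proj tail_proj_decreasing that)
    then show ?thesis
      by (simp add: a_def power2_norm_eq_inner inner_simps inner_commute)
  qed
  have "decseq a"
  proof (rule decseq_SucI)
    show "a (Suc n) \<le> a n" for n using diff[of n "Suc n"] by (metis le_add2 plus_1_eq_Suc diff_ge_0_iff_ge zero_le_power2)
  qed
  then obtain l where "a \<longlonglongrightarrow> l"
    using decseq_convergent[of a 0] by (auto simp: a_def)
  then have "Cauchy a" by (rule LIMSEQ_imp_Cauchy)
  show ?thesis
  proof (rule metric_CauchyI)
    fix e :: real assume "e > 0"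
    then obtain N where N: "\<And>m n. m \<ge> N \<Longrightarrow> n \<ge> N \<Longrightarrow> dist (a m) (a n) < e\<^sup>2"
      using metric_CauchyD[OF \<open>Cauchy a\<close>, of "e\<^sup>2"] by auto
    have le: "dist (tail_proj m v) (tail_proj n v) < e" if "N \<le> m" "m \<le> n" for m n
    proof (rule power2_less_imp_less)
      show "(dist (tail_proj m v) (tail_proj n v))\<^sup>2 < e\<^sup>2"
        using diff[OF that(2)] N[of m n] that by (simp add: dist_norm)
    qed (use \<open>e > 0\<close> in simp)
    show "\<exists>N. \<forall>m\<ge>N. \<forall>n\<ge>N. dist (tail_proj m v) (tail_proj n v) < e"
    proof (intro exI allI impI)
      fix m n assume "N \<le> m" "N \<le> n"
      then show "dist (tail_proj m v) (tail_proj n v) < e"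
        using le[of m n] le[of n m] by (cases "m \<le> n") (auto simp: dist_commute)
    qed
  qed
qed

lemma approximant_on_tail: "m \<le> n \<Longrightarrow> approximant m (tail_proj n v) = A (tail_proj n v)"
proof (induction m arbitrary: n v)
  case (Suc m)
  then obtain k where n: "n = Suc k" "m \<le> k" by (cases n) auto
  define w where "w = tail_proj n v"
  have R: "R w = w"
    unfolding w_def n tail_proj_Suc by (rule ampl_id_fixes_ampl(1)[OF S S tail_proj_initial])
  have "approximant m o\<^sub>L tail_proj k = A o\<^sub>L tail_proj k"
    by (rule blinfun_eqI) (simp add: Suc.IH n)
  then have "ampl E S S' (approximant m) w = ampl E S S' A w"
    unfolding w_def n tail_proj_Suc by (simp add: ampl_compose[OF S S S' tail_proj_initial])
  then have "diagonal_step E S S' A (approximant m) w = A w"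
    using R'_A_R[of w] by (simp add: diagonal_step_def blinfun.bilinear_simps ampl_similarity R)
  then show ?case by (simp add: approximant_Suc w_def)
qed (simp add: approximant_def)

text \<open>
  Later steps change nothing on the orthogonal complement of the words of length \<open>m\<close>.
\<close>

lemma approximant_diff:
  "m \<le> n \<Longrightarrow> (approximant n - approximant m) (tail_proj m v) = (approximant n - approximant m) v"
proof (induction m arbitrary: n v)
  case (Suc m)
  then obtain k where n: "n = Suc k" "m \<le> k" by (cases n) auto
  define X where "X = approximant k - approximant m"
  have "approximant n - approximant (Suc m) = ampl E S S' X"
    by (rule blinfun_eqI)
      (simp add: n approximant_Suc diagonal_step_def X_def ampl_diff[OF S S'] blinfun.bilinear_simps)
  moreover have "X o\<^sub>L tail_proj m = X"
    by (rule blinfun_eqI) (simp add: X_def Suc.IH n)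
  ultimately show ?case
    by (simp add: tail_proj_Suc ampl_compose[OF S S S' tail_proj_initial])
qed (simp add: tail_proj_def)

text \<open>
  For \<open>m \<le> n\<close> the approximants agree where \<open>Z m\<close> vanishes and, being equal to \<open>A\<close>, also on the range of
  \<open>Z n\<close>. Hence their difference at \<open>v\<close> is their difference at \<open>Z m v - Z n v\<close>, which is small.
\<close>

lemma approximant_convergent: "convergent (\<lambda>n. approximant n v)"
proof -
  have bound: "norm (approximant n v - approximant m v) \<le> 2 * norm A * norm (tail_proj m v - tail_proj n v)"
    if "m \<le> n" for m n
  proof -
    have "approximant n v - approximant m v
        = (approximant n - approximant m) (tail_proj m v - tail_proj n v)"
      using approximant_diff[OF that, of v] approximant_on_tail[OF that, of v]
        approximant_on_tail[of n n v]
      by (simp add: blinfun.bilinear_simps)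
    also have "norm \<dots> \<le> norm (approximant n - approximant m) * norm (tail_proj m v - tail_proj n v)"
      by (rule norm_blinfun)
    also have "\<dots> \<le> 2 * norm A * norm (tail_proj m v - tail_proj n v)"
      using norm_triangle_ineq4[of "approximant n" "approximant m"]
        norm_approximant[of n] norm_approximant[of m] by (intro mult_right_mono) auto
    finally show ?thesis .
  qed
  have "Cauchy (\<lambda>n. approximant n v)"
  proof (rule metric_CauchyI)
    fix e :: real assume "e > 0"
    define d where "d = e / (2 * norm A + 1)"
    have pos: "0 < 2 * norm A + 1" by (simp add: add_nonneg_pos)
    then have "d > 0" using \<open>e > 0\<close> by (simp add: d_def)
    then obtain N where N: "\<And>m n. m \<ge> N \<Longrightarrow> n \<ge> N \<Longrightarrow> dist (tail_proj m v) (tail_proj n v) < d"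
      using metric_CauchyD[OF tail_proj_Cauchy] by meson
    have le: "dist (approximant m v) (approximant n v) < e" if "N \<le> m" "m \<le> n" for m n
    proof -
      have "dist (approximant m v) (approximant n v) \<le> 2 * norm A * norm (tail_proj m v - tail_proj n v)"
        using bound[OF that(2)] by (simp add: dist_norm norm_minus_commute)
      also have "\<dots> \<le> 2 * norm A * d"
        using N[of m n] that by (intro mult_left_mono) (auto simp: dist_norm)
      also have "\<dots> < (2 * norm A + 1) * d" using \<open>d > 0\<close> by (simp add: distrib_right)
      also have "\<dots> = e" using pos by (simp add: d_def)
      finally show ?thesis .
    qed
    show "\<exists>N. \<forall>m\<ge>N. \<forall>n\<ge>N. dist (approximant m v) (approximant n v) < e"
    proof (intro exI allI impI)
      fix m n assume "N \<le> m" "N \<le> n"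
      then show "dist (approximant m v) (approximant n v) < e"
        using le[of m n] le[of n m] by (cases "m \<le> n") (auto simp: dist_commute)
    qed
  qed
  then show ?thesis by (simp add: Cauchy_convergent)
qed

text \<open>
  The approximants and the approximants for the inverse similarity are mutually inverse, uniformly
  bounded and strongly convergent, so their limits are mutually inverse. By \<open>step_row\<close>, moving \<open>S e\<close> or
  its adjoint through an approximant shifts the index by one, which the limit does not notice.
\<close>

lemma star_similarity:
  "\<exists>(B :: 'a \<Rightarrow>\<^sub>L 'b) B'. B' o\<^sub>L B = id_blinfun \<and> B o\<^sub>L B' = id_blinfun \<and>
     intertwines M B \<and> (\<forall>e\<in>E. star_intertwines B (S e) (S' e))"
proof -
  interpret swap: similar_rows E S' S "M\<inverse>" C A by (rule swap)
  obtain B where B: "\<And>v. (\<lambda>n. approximant n v) \<longlonglongrightarrow> blinfun_apply B v"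
    using strong_limit[OF approximant_convergent norm_approximant] by blast
  obtain B' where B': "\<And>w. (\<lambda>n. swap.approximant n w) \<longlonglongrightarrow> blinfun_apply B' w"
    using strong_limit[OF swap.approximant_convergent swap.norm_approximant] by blast
  have inv: "(\<forall>v. swap.approximant n (approximant n v) = v) \<and>
      (\<forall>w. approximant n (swap.approximant n w) = w)" for n
  proof (induction n)
    case (Suc n)
    then show ?case
      unfolding swap.approximant_Suc approximant_Suc
      using step_inverse[OF approximant_intertwines] swap.step_inverse[OF swap.approximant_intertwines]
      by blast
  qed (simp add: swap.approximant_def approximant_def C_A A_C)
  have "B (D v) = D' (B v)" if "(D, D') \<in> M" for D D' v
  proof (rule LIMSEQ_unique[OF B])
    have "approximant n (D v) = D' (approximant n v)" for n
      using approximant_intertwines that by (auto simp: intertwines_def)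
    then show "(\<lambda>n. approximant n (D v)) \<longlonglongrightarrow> D' (B v)"
      by (simp add: blinfun.tendsto[OF tendsto_const B])
  qed
  moreover have "B (S e v) = S' e (B v)" if "e \<in> E" for e v
  proof (rule LIMSEQ_unique[OF LIMSEQ_Suc[OF B]])
    show "(\<lambda>n. approximant (Suc n) (S e v)) \<longlonglongrightarrow> S' e (B v)"
      unfolding approximant_Suc step_row(1)[OF approximant_intertwines that]
      by (rule blinfun.tendsto[OF tendsto_const B])
  qed
  moreover have "B (adj (S e) v) = adj (S' e) (B v)" if "e \<in> E" for e v
  proof (rule LIMSEQ_unique[OF B])
    show "(\<lambda>n. approximant n (adj (S e) v)) \<longlonglongrightarrow> adj (S' e) (B v)"
      unfolding step_row(2)[OF approximant_intertwines that, symmetric] approximant_Suc[symmetric]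
      by (rule blinfun.tendsto[OF tendsto_const LIMSEQ_Suc[OF B]])
  qed
  moreover have "B' o\<^sub>L B = id_blinfun"
    by (rule blinfun_eqI, simp, rule strong_limit_inverse[OF B B' swap.norm_approximant]) (use inv in blast)
  moreover have "B o\<^sub>L B' = id_blinfun"
    by (rule blinfun_eqI, simp, rule strong_limit_inverse[OF B' B norm_approximant]) (use inv in blast)
  ultimately have "intertwines M B" "\<forall>e\<in>E. star_intertwines B (S e) (S' e)"
    "B' o\<^sub>L B = id_blinfun" "B o\<^sub>L B' = id_blinfun"
    by (auto simp: intertwines_def star_intertwines_def)
  then show ?thesis by blast
qed

end

section \<open>Complex Hilbert spaces and graph families\<close>

lemma cinner_scaleC_right: "cinner x (scaleC c y) = cnj c * cinner x y"
  by (metis cinner_commute cinner_scaleC_left complex_cnj_mult)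

text \<open>
  The real inner product and multiplication by \<open>\<i>\<close> determine the complex inner product. Hence for
  complex linear operators the complex adjoint coincides with the adjoint of the underlying
  real Hilbert spaces.
\<close>

lemma cinner_eq: "cinner x y = Complex (inner x y) (inner x (scaleC \<i> y))"
  by (simp add: complex_eq_iff inner_eq_Re_cinner cinner_scaleC_right)

lemma norm_scaleC: "norm (scaleC c x) = cmod c * norm x"
proof -
  have "inner (scaleC c x) (scaleC c x) = Re ((c * cnj c) * cinner x x)"
    by (simp add: inner_eq_Re_cinner cinner_scaleC_left cinner_scaleC_right mult_ac)
  also have "\<dots> = (cmod c)\<^sup>2 * inner x x"
    by (simp only: complex_norm_square[symmetric]) (simp add: inner_eq_Re_cinner flip: of_real_power)
  finally show ?thesis by (simp add: norm_eq_sqrt_inner real_sqrt_mult)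
qed

definition scaleC_op :: "complex \<Rightarrow> 'a::chilbert_space \<Rightarrow>\<^sub>L 'a" where
  "scaleC_op c = Blinfun (scaleC c)"

lemma scaleC_op_apply [simp]: "scaleC_op c x = scaleC c x"
proof -
  have "bounded_linear (scaleC c :: 'a \<Rightarrow> 'a)"
  proof (rule bounded_linear_intro)
    show "scaleC c (r *\<^sub>R x) = r *\<^sub>R scaleC c x" for r and x :: 'a
      by (simp add: scaleC_scaleC mult.commute flip: scaleC_of_real)
    show "norm (scaleC c x) \<le> norm x * cmod c" for x :: 'a
      by (simp add: norm_scaleC mult.commute)
  qed (rule scaleC_add_right)
  then show ?thesis by (simp add: scaleC_op_def bounded_linear_Blinfun_apply)
qed

lemma adj_scaleC_op: "adj (scaleC_op c) = scaleC_op (cnj c)"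
  by (rule adj_eqI) (simp add: inner_eq_Re_cinner cinner_scaleC_left cinner_scaleC_right)

lemma scaleC_one [simp]: "scaleC 1 x = x" and scaleC_zero [simp]: "scaleC 0 x = 0"
  using scaleC_of_real[of 1 x] scaleC_of_real[of 0 x] by simp_all

lemma adj_scaleC:
  fixes T :: "'a::chilbert_space \<Rightarrow>\<^sub>L 'b::chilbert_space"
  assumes T: "\<And>c x. T (scaleC c x) = scaleC c (T x)"
  shows "adj T (scaleC c y) = scaleC c (adj T y)"
proof -
  have "T o\<^sub>L scaleC_op (cnj c) = scaleC_op (cnj c) o\<^sub>L T"
    by (rule blinfun_eqI) (simp add: T)
  then have "adj (T o\<^sub>L scaleC_op (cnj c)) = adj (scaleC_op (cnj c) o\<^sub>L T)" by simp
  then have "scaleC_op c o\<^sub>L adj T = adj T o\<^sub>L scaleC_op c"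
    by (simp add: adj_compose adj_scaleC_op)
  then show ?thesis
    by (metis blinfun_apply_blinfun_compose scaleC_op_apply)
qed

lemma cadjoint_blinfun:
  fixes T :: "'a::chilbert_space \<Rightarrow>\<^sub>L 'b::chilbert_space"
  assumes T: "\<And>c x. T (scaleC c x) = scaleC c (T x)"
  shows "cadjoint T = adj T"
  unfolding cadjoint_def
proof (rule the_equality)
  show "\<forall>x y. cinner (T x) y = cinner x (adj T y)"
    by (simp add: cinner_eq inner_adj_right flip: adj_scaleC[OF T])
  fix T' assume T': "\<forall>x y. cinner (T x) y = cinner x (T' y)"
  show "T' = adj T"
  proof
    fix y
    have "inner x (T' y) = inner x (adj T y)" for x
      using T' inner_adj_right[of x T y] by (simp only: inner_eq_Re_cinner)
    then show "T' y = adj T y" using vector_eq_ldot by blast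
  qed
qed

lemma bounded_clinear_Blinfun:
  assumes "bounded_clinear T"
  shows "blinfun_apply (Blinfun T) = T"
  using assms by (simp add: bounded_clinear_def bounded_linear_Blinfun_apply)

locale graph_family =
  fixes G :: "('v, 'e) pre_digraph" and S :: "'e \<Rightarrow> 'h::chilbert_space \<Rightarrow> 'h" and P :: "'v \<Rightarrow> 'h \<Rightarrow> 'h"
  assumes wf: "wf_digraph G" and dagger: "dagger_family G S P"
begin

definition edge_op :: "'e \<Rightarrow> 'h \<Rightarrow>\<^sub>L 'h" where "edge_op e = Blinfun (S e)"
definition vertex_op :: "'v \<Rightarrow> 'h \<Rightarrow>\<^sub>L 'h" where "vertex_op x = Blinfun (P x)"

lemma head_in_verts: "e \<in> arcs G \<Longrightarrow> head G e \<in> verts G"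
  and tail_in_verts: "e \<in> arcs G \<Longrightarrow> tail G e \<in> verts G"
  using wf by (auto simp: wf_digraph_def)

lemma edge_op_apply: "blinfun_apply (edge_op e) = S e"
  and edge_op_scaleC: "edge_op e (scaleC c v) = scaleC c (edge_op e v)"
  and cadjoint_edge: "cadjoint (S e) = adj (edge_op e)"
  if e: "e \<in> arcs G"
proof -
  have S: "bounded_clinear (S e)"
    using dagger e by (simp add: dagger_family_def partial_isometry_def)
  then show eq: "blinfun_apply (edge_op e) = S e"
    by (simp add: edge_op_def bounded_clinear_Blinfun)
  show scaleC: "edge_op e (scaleC c v) = scaleC c (edge_op e v)" for c v
    unfolding eq using S by (simp add: bounded_clinear_def)
  show "cadjoint (S e) = adj (edge_op e)"
    using cadjoint_blinfun[of "edge_op e", OF scaleC] by (simp add: eq)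
qed

lemma vertex_op_apply: "blinfun_apply (vertex_op x) = P x"
  and adj_vertex_op: "adj (vertex_op x) = vertex_op x"
  and vertex_op_idem: "vertex_op x (vertex_op x v) = vertex_op x v"
  if x: "x \<in> verts G"
proof -
  have P: "orthogonal_projection (P x)" using dagger x by (simp add: dagger_family_def)
  then have clin: "bounded_clinear (P x)" by (simp add: orthogonal_projection_def)
  then show eq: "blinfun_apply (vertex_op x) = P x"
    by (simp add: vertex_op_def bounded_clinear_Blinfun)
  have scaleC: "vertex_op x (scaleC c v) = scaleC c (vertex_op x v)" for c v
    unfolding eq using clin by (simp add: bounded_clinear_def)
  show "adj (vertex_op x) = vertex_op x"
    using cadjoint_blinfun[of "vertex_op x", OF scaleC] P
    by (simp add: eq orthogonal_projection_def flip: blinfun_apply_inject)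
  show "vertex_op x (vertex_op x v) = vertex_op x v"
    unfolding eq using P by (metis comp_apply orthogonal_projection_def)
qed

lemma initial_projection: "e \<in> arcs G \<Longrightarrow> adj (edge_op e) o\<^sub>L edge_op e = vertex_op (tail G e)"
proof (rule blinfun_eqI)
  fix v assume e: "e \<in> arcs G"
  have "cadjoint (S e) \<circ> S e = P (tail G e)" using dagger e by (simp add: dagger_family_def)
  then show "(adj (edge_op e) o\<^sub>L edge_op e) v = vertex_op (tail G e) v"
    using e by (simp add: edge_op_apply vertex_op_apply tail_in_verts fun_eq_iff flip: cadjoint_edge)
qed

text \<open>
  For \<open>p = (S e)\<^sup>* S e\<close> one has \<open>\<parallel>S e (v - p v)\<parallel>\<^sup>2 = \<langle>v - p v, p (v - p v)\<rangle> = 0\<close> since \<open>p\<close> is idempotent.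
\<close>

lemma edge_row: "isometry_row (arcs G) edge_op"
proof -
  have "edge_op e (adj (edge_op e) (edge_op e v)) = edge_op e v" if e: "e \<in> arcs G" for e v
  proof -
    define p where "p = vertex_op (tail G e)"
    have p: "adj (edge_op e) (edge_op e w) = p w" for w
      using initial_projection[OF e] unfolding p_def by (metis blinfun_apply_blinfun_compose)
    have "inner (edge_op e (v - p v)) (edge_op e (v - p v)) = inner (v - p v) (p (v - p v))"
      by (simp add: inner_adj_right flip: p)
    also have "p (v - p v) = 0"
      using vertex_op_idem[OF tail_in_verts[OF e]] by (simp add: p_def blinfun.bilinear_simps)
    finally have "edge_op e v - edge_op e (p v) = 0" by (simp add: blinfun.bilinear_simps)
    then have "edge_op e (p v) = edge_op e v" by simp
    then show ?thesis by (simp only: p)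
  qed
  moreover have "adj (edge_op e) (edge_op f v) = 0"
    if "e \<in> arcs G" "f \<in> arcs G" "e \<noteq> f" for e f v
  proof -
    have "cadjoint (S e) \<circ> S f = (\<lambda>_. 0)" using dagger that by (simp add: dagger_family_def)
    then show ?thesis using that by (simp add: edge_op_apply fun_eq_iff flip: cadjoint_edge)
  qed
  ultimately show ?thesis by (simp add: isometry_row_def)
qed

text \<open>
  Let \<open>T\<close> be the sum of the range projections of the edges with range \<open>y\<close>. It fixes the vectors \<open>w\<close> in the
  range of each of these edges, so \<open>T \<le> P y\<close> yields \<open>\<parallel>w\<parallel>\<^sup>2 \<le> \<langle>P y w, w\<rangle> = \<parallel>P y w\<parallel>\<^sup>2\<close>,
  which forces \<open>P y w = w\<close>. The other vertex projections then kill \<open>w\<close> by orthogonality.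
\<close>

lemma vertex_edge:
  assumes x: "x \<in> verts G" and e: "e \<in> arcs G"
  shows "vertex_op x (edge_op e v) = (if head G e = x then edge_op e v else 0)"
proof -
  define y w where "y = head G e" and "w = edge_op e v"
  have y: "y \<in> verts G" using head_in_verts[OF e] by (simp add: y_def)
  obtain T where T: "has_sum_strong (\<lambda>e. S e \<circ> cadjoint (S e)) T {e \<in> arcs G. head G e = y}"
    and le: "operator_le T (P y)"
    using dagger y by (auto simp: dagger_family_def)
  have summand: "(S f \<circ> cadjoint (S f)) w = edge_op f (adj (edge_op f) w)" if "f \<in> arcs G" for f
    by (simp add: that cadjoint_edge edge_op_apply)
  have "((\<lambda>f. (S f \<circ> cadjoint (S f)) w) has_sum (S e \<circ> cadjoint (S e)) w) {f \<in> arcs G. head G f = y}"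
  proof (rule has_sum_single)
    show "(S f \<circ> cadjoint (S f)) w = 0" if "f \<in> {f \<in> arcs G. head G f = y}" "f \<noteq> e" for f
      using that isometry_row_simps(3)[OF edge_row _ e, of f] summand[of f]
      by (simp add: w_def del: comp_apply)
  qed (use e in \<open>simp add: y_def\<close>)
  then have "T w = (S e \<circ> cadjoint (S e)) w"
    using T has_sum_unique unfolding has_sum_strong_def by blast
  also have "\<dots> = w"
    using isometry_row_simps(1)[OF edge_row e] summand[OF e]
    by (simp add: w_def del: comp_apply)
  finally have Tw: "T w = w" .
  define p where "p = vertex_op y"
  have idem: "p (p w) = p w" and self: "adj p = p"
    using y by (simp_all add: p_def vertex_op_idem adj_vertex_op)
  have "0 \<le> Re (cinner (P y w - T w) w)"
    using le by (auto simp: operator_le_def complex_nonneg_Reals_iff)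
  then have "inner w w \<le> inner (p w) w"
    using y by (simp add: Tw p_def vertex_op_apply inner_eq_Re_cinner[symmetric] inner_simps)
  moreover have "inner (p w) (p w) = inner (p w) w"
    using inner_adj_left[of p "p w" w] inner_adj_left[of p w "p w"] by (simp add: self idem inner_commute)
  ultimately have "inner (w - p w) (w - p w) \<le> 0"
    by (simp add: inner_simps inner_commute)
  then have "inner (w - p w) (w - p w) = 0" using inner_ge_zero[of "w - p w"] by linarith
  then have pw: "p w = w" by simp
  show ?thesis
  proof (cases "head G e = x")
    case True
    then show ?thesis using pw by (simp add: p_def y_def w_def)
  next
    case False
    have "P x \<circ> P y = (\<lambda>_. 0)" using dagger x y False by (simp add: dagger_family_def y_def)
    then have "vertex_op x (p w) = 0"
      using x y by (simp add: p_def vertex_op_apply fun_eq_iff)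
    then show ?thesis using False by (simp add: pw) (simp add: w_def)
  qed
qed

lemma vertex_row:
  assumes x: "x \<in> verts G" and e: "e \<in> arcs G"
  shows "vertex_op x (edge_op e v) = edge_op e (scaleC_op (of_bool (head G e = x)) v)"
    and "adj (edge_op e) (vertex_op x v) = scaleC_op (of_bool (head G e = x)) (adj (edge_op e) v)"
proof -
  show "vertex_op x (edge_op e v) = edge_op e (scaleC_op (of_bool (head G e = x)) v)"
    using vertex_edge[OF x e] by simp
  have "vertex_op x o\<^sub>L edge_op e = (if head G e = x then edge_op e else 0)"
    by (rule blinfun_eqI) (simp add: vertex_edge[OF x e])
  then have "adj (edge_op e) o\<^sub>L vertex_op x = (if head G e = x then adj (edge_op e) else 0)"
    using adj_compose[of "vertex_op x" "edge_op e"]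
    by (cases "head G e = x") (simp_all add: adj_vertex_op[OF x])
  then have "(adj (edge_op e) o\<^sub>L vertex_op x) v = (if head G e = x then adj (edge_op e) else 0) v"
    by (rule arg_cong)
  then show "adj (edge_op e) (vertex_op x v) = scaleC_op (of_bool (head G e = x)) (adj (edge_op e) v)"
    by (cases "head G e = x") simp_all
qed

lemma scaleC_row:
  assumes "e \<in> arcs G"
  shows "scaleC_op c (edge_op e v) = edge_op e (scaleC_op c v)"
    and "adj (edge_op e) (scaleC_op c v) = scaleC_op c (adj (edge_op e) v)"
  using edge_op_scaleC[OF assms] adj_scaleC[of "edge_op e"] by simp_all

end

theorem theorem3p1:
  fixes G :: "('v, 'e) pre_digraph"
    and S :: "'e \<Rightarrow> 'h::chilbert_space \<Rightarrow> 'h"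
    and P :: "'v \<Rightarrow> 'h \<Rightarrow> 'h"
    and S' :: "'e \<Rightarrow> 'k::chilbert_space \<Rightarrow> 'k"
    and P' :: "'v \<Rightarrow> 'k \<Rightarrow> 'k"
  assumes "wf_digraph G"
    and "countable (verts G)" and "countable (arcs G)"
    and no_sinks: "\<forall>x\<in>verts G. \<exists>e\<in>arcs G. tail G e = x"
    and "dagger_family G S P"
    and "dagger_family G S' P'"
    and similar: "\<exists>A :: 'h \<Rightarrow> 'k. bounded_invertible A \<and>
          (\<forall>e\<in>arcs G. A \<circ> S e \<circ> inv A = S' e) \<and>
          (\<forall>x\<in>verts G. A \<circ> P x \<circ> inv A = P' x)"
  shows "\<exists>U :: 'h \<Rightarrow> 'k. unitary U \<and>
          (\<forall>e\<in>arcs G. U \<circ> S e \<circ> cadjoint U = S' e) \<and>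
          (\<forall>x\<in>verts G. U \<circ> P x \<circ> cadjoint U = P' x)"
proof -
  interpret F: graph_family G S P by (rule graph_family.intro) fact+
  interpret F': graph_family G S' P' by (rule graph_family.intro) fact+
  obtain A :: "'h \<Rightarrow> 'k" where A: "bounded_clinear A" "bij A" "bounded_clinear (inv A)"
    and AS: "\<And>e. e \<in> arcs G \<Longrightarrow> A \<circ> S e \<circ> inv A = S' e"
    and AP: "\<And>x. x \<in> verts G \<Longrightarrow> A \<circ> P x \<circ> inv A = P' x"
    using similar by (auto simp: bounded_invertible_def)
  have inv: "inv A (A v) = v" "A (inv A w) = w" for v w
    using A(2) by (simp_all add: bij_is_inj bij_is_surj surj_f_inv_f)
  define a c where "a = Blinfun A" and "c = Blinfun (inv A)"
  have a: "blinfun_apply a = A" and c: "blinfun_apply c = inv A"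
    using A by (simp_all add: a_def c_def bounded_clinear_Blinfun)
  have ac: "c (a v) = v" "a (c w) = w" for v w by (simp_all add: a c inv)
  have aS: "a (F.edge_op e v) = F'.edge_op e (a v)" if "e \<in> arcs G" for e v
    using fun_cong[OF AS[OF that], of "A v"]
    by (simp add: a F.edge_op_apply F'.edge_op_apply that inv)
  have aP: "a (F.vertex_op x v) = F'.vertex_op x (a v)" if "x \<in> verts G" for x v
    using fun_cong[OF AP[OF that], of "A v"]
    by (simp add: a F.vertex_op_apply F'.vertex_op_apply that inv)
  define M :: "(('h \<Rightarrow>\<^sub>L 'h) \<times> ('k \<Rightarrow>\<^sub>L 'k)) set"
    where "M = (\<lambda>x. (F.vertex_op x, F'.vertex_op x)) ` verts G \<union> range (\<lambda>z. (scaleC_op z, scaleC_op z))"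
  interpret similar_rows "arcs G" F.edge_op F'.edge_op M a c
  proof
    show "intertwines M a"
      using A(1) by (auto simp: intertwines_def M_def aP) (simp add: a bounded_clinear_def)
    show "(adj (F.edge_op e) o\<^sub>L F.edge_op e, adj (F'.edge_op e) o\<^sub>L F'.edge_op e) \<in> M"
      if "e \<in> arcs G" for e
      using that by (auto simp: M_def F.initial_projection F'.initial_projection F.tail_in_verts)
    fix D D' e assume D: "(D, D') \<in> M" and e: "e \<in> arcs G"
    have scalar: "(scaleC_op z, scaleC_op z) \<in> M" for z by (simp add: M_def)
    from D consider x where "x \<in> verts G" "D = F.vertex_op x" "D' = F'.vertex_op x"
      | z where "D = scaleC_op z" "D' = scaleC_op z"
      by (auto simp: M_def)
    then show "\<exists>F F'. (F, F') \<in> M \<and>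
      (\<forall>v. D (F.edge_op e v) = F.edge_op e (F v)) \<and> (\<forall>v. adj (F.edge_op e) (D v) = F (adj (F.edge_op e) v)) \<and>
      (\<forall>w. D' (F'.edge_op e w) = F'.edge_op e (F' w)) \<and>
      (\<forall>w. adj (F'.edge_op e) (D' w) = F' (adj (F'.edge_op e) w))"
    proof cases
      case 1
      then show ?thesis
        using scalar F.vertex_row[OF _ e] F'.vertex_row[OF _ e] by blast
    next
      case 2
      then show ?thesis
        using scalar F.scaleC_row[OF e] F'.scaleC_row[OF e] by blast
    qed
  qed (simp_all add: F.edge_row F'.edge_row ac aS)
  obtain B B' where BB: "B' o\<^sub>L B = id_blinfun" "B o\<^sub>L B' = id_blinfun"
    and BM: "intertwines M B"
    and BS: "\<And>e. e \<in> arcs G \<Longrightarrow> star_intertwines B (F.edge_op e) (F'.edge_op e)"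
    using star_similarity by blast
  have B_inv: "B' (B v) = v" "B (B' w) = w" for v w
    using BB by (metis blinfun_apply_blinfun_compose blinfun_apply_id_blinfun id_apply)+
  obtain U where U: "\<And>v. adj U (U v) = v" "\<And>w. blinfun_apply U (adj U w) = w"
    and star: "\<And>T T'. star_intertwines B T T' \<Longrightarrow> star_intertwines U T T'"
    using unitary_part[of B' B, OF B_inv] by blast
  have US: "U (F.edge_op e v) = F'.edge_op e (U v)" if "e \<in> arcs G" for e v
    using star[OF BS[OF that]] by (simp add: star_intertwines_def)
  have UP: "U (F.vertex_op x v) = F'.vertex_op x (U v)" if "x \<in> verts G" for x v
  proof -
    have "star_intertwines B (F.vertex_op x) (F'.vertex_op x)"
      using BM that
      by (simp add: star_intertwines_def intertwines_def M_def F.adj_vertex_op F'.adj_vertex_op)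
    then show ?thesis using star by (simp add: star_intertwines_def)
  qed
  have U_scaleC: "U (scaleC z v) = scaleC z (U v)" for z v
  proof -
    have "B (scaleC_op z v) = scaleC_op z (B v)" for z v
      using BM unfolding intertwines_def M_def by blast
    then have "star_intertwines B (scaleC_op z) (scaleC_op z)"
      unfolding star_intertwines_def adj_scaleC_op by blast
    then have "star_intertwines U (scaleC_op z) (scaleC_op z)" by (rule star)
    then show ?thesis by (simp add: star_intertwines_def)
  qed
  have cadjoint_U: "cadjoint U = adj U" by (rule cadjoint_blinfun[OF U_scaleC])
  have "unitary U"
    using U U_scaleC
    by (auto simp: unitary_def bounded_clinear_def cadjoint_U blinfun.bounded_linear_right)
  moreover have "U \<circ> S e \<circ> cadjoint U = S' e" if "e \<in> arcs G" for e
    using US[OF that] U(2)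
    by (simp add: cadjoint_U fun_eq_iff that flip: F.edge_op_apply F'.edge_op_apply)
  moreover have "U \<circ> P x \<circ> cadjoint U = P' x" if "x \<in> verts G" for x
    using UP[OF that] U(2)
    by (simp add: cadjoint_U fun_eq_iff that flip: F.vertex_op_apply F'.vertex_op_apply)
  ultimately show ?thesis by blast
qed

end
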